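(* Let $G$ be a finite group, let $g\in G$ with $g\neq 1$, and let $\pi=\pi(o(g))$ be the set of prime divisors of the order $o(g)$ of $g$. Write $g=\prod_{p\in\pi}g_{p}$, where each $g_{p}$ is a $p$-element for $p\in\pi$ and $g_{p}g_{q}=g_{q}g_{p}$ for all $p,q\in\pi$. Then $g$ is a dominating vertex for the cyclic graph $\Delta(G)$ if and only if, for each $p\in\pi$, a Sylow $p$-subgroup $P$ of $G$ is cyclic or generalized quaternion and $\langle g_{p}\rangle\le P\cap\mathbf{Z}(G)$.
   Context: For a group $G$, the cyclic graph $\Delta(G)$ is the simple graph whose vertex set is $G^{\#}=G\setminus\{1\}$, with an edge between distinct vertices $x,y$ if and only if the subgroup $\langle x,y\rangle$ is cyclic. A vertex $z$ of $\Delta(G)$ is a dominating vertex if $z$ is adjacent to every vertex other than $z$. A $p$-element is an element whose order is a power of $p$. $\mathbf{Z}(G)$ denotes the center of $G$. Generalized quaternion groups are those of order $2^n$, $n\ge 3$, including the quaternion group of order $8$. *)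

theory Defs
  imports
    "HOL-Computational_Algebra.Primes"
    "HOL-Algebra.Elementary_Groups"
    "HOL-Algebra.Multiplicative_Group"
    "HOL-Algebra.Sylow"
    "Graph_Theory.Pair_Digraph"
begin

text \<open>A simple graph is a \<^locale>\<open>pair_graph\<close>: an undirected edge between two vertices is
  the pair of opposite arcs.\<close>

definition cyclic_graph :: "('a, 'b) monoid_scheme \<Rightarrow> 'a pair_pre_digraph" where
  "cyclic_graph G =
     \<lparr> pverts = carrier G - {\<one>\<^bsub>G\<^esub>},
       parcs = {(x, y). x \<in> carrier G - {\<one>\<^bsub>G\<^esub>} \<and> y \<in> carrier G - {\<one>\<^bsub>G\<^esub>} \<and> x \<noteq> y \<and>
                        cyclic_group (subgroup_generated G {x, y})} \<rparr>"

lemma pair_graph_cyclic_graph: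
  assumes "finite (carrier G)"
  shows "pair_graph (cyclic_graph G)"
proof
  show "finite (pverts (cyclic_graph G))"
    using assms by (simp add: cyclic_graph_def)
  show "finite (parcs (cyclic_graph G))"
    by (rule finite_subset[of _ "carrier G \<times> carrier G"])
       (use assms in \<open>auto simp: cyclic_graph_def\<close>)
  show "symmetric (cyclic_graph G)"
    by (auto simp: symmetric_def cyclic_graph_def insert_commute intro: symI)
qed (auto simp: cyclic_graph_def)

definition dominating_vertex :: "'a pair_pre_digraph \<Rightarrow> 'a \<Rightarrow> bool" where
  "dominating_vertex \<Gamma> z \<longleftrightarrow>
     z \<in> pverts \<Gamma> \<and> (\<forall>x \<in> pverts \<Gamma>. x \<noteq> z \<longrightarrow> (z, x) \<in> parcs \<Gamma>)"

definition group_center :: "('a, 'b) monoid_scheme \<Rightarrow> 'a set" where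
  "group_center G = {z \<in> carrier G. \<forall>x \<in> carrier G. z \<otimes>\<^bsub>G\<^esub> x = x \<otimes>\<^bsub>G\<^esub> z}"

definition p_element :: "('a, 'b) monoid_scheme \<Rightarrow> nat \<Rightarrow> 'a \<Rightarrow> bool" where
  "p_element G p x \<longleftrightarrow> x \<in> carrier G \<and> (\<exists>k. group.ord G x = p ^ k)"

definition sylow_subgroup :: "('a, 'b) monoid_scheme \<Rightarrow> nat \<Rightarrow> 'a set \<Rightarrow> bool" where
  "sylow_subgroup G p P \<longleftrightarrow>
     prime p \<and> subgroup P G \<and> card P = p ^ multiplicity p (order G)"

text \<open>The relations below present the generalized quaternion group, whose order is \<open>2 ^ n\<close>.
  A group of that same order generated by elements satisfying them is therefore isomorphic to
  it; in particular \<open>x\<close> then has order exactly \<open>2 ^ (n - 1)\<close>.\<close>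

definition generalized_quaternion :: "('a, 'b) monoid_scheme \<Rightarrow> bool" where
  "generalized_quaternion G \<longleftrightarrow>
     group G \<and>
     (\<exists>n::nat. n \<ge> 3 \<and> order G = 2 ^ n \<and>
       (\<exists>x \<in> carrier G. \<exists>y \<in> carrier G.
          generate G {x, y} = carrier G \<and>
          x [^]\<^bsub>G\<^esub> (2 ^ (n - 1) :: nat) = \<one>\<^bsub>G\<^esub> \<and>
          y [^]\<^bsub>G\<^esub> (2 :: nat) = x [^]\<^bsub>G\<^esub> (2 ^ (n - 2) :: nat) \<and>
          inv\<^bsub>G\<^esub> y \<otimes>\<^bsub>G\<^esub> x \<otimes>\<^bsub>G\<^esub> y = inv\<^bsub>G\<^esub> x))"

text \<open>The library develops \<^const>\<open>finprod\<close> for commutative monoids, but its definition yields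
  the expected order-independent product for pairwise commuting factors in any group, as the
  following recursion confirms.\<close>

lemma (in group) finprod_commuting_empty: "finprod G f {} = \<one>"
  by (simp add: finprod_def foldD_empty)

lemma (in group) finprod_commuting_insert:
  assumes "finite A" "a \<notin> A"
    and closed: "\<And>i. i \<in> insert a A \<Longrightarrow> f i \<in> carrier G"
    and comm: "\<And>i j. i \<in> insert a A \<Longrightarrow> j \<in> insert a A \<Longrightarrow> f i \<otimes> f j = f j \<otimes> f i"
  shows "finprod G f (insert a A) = f a \<otimes> finprod G f A"
proof -
  interpret LCD "insert a A" "carrier G" "(\<otimes>) \<circ> f"
    by unfold_locales (auto simp: closed m_assoc[symmetric] comm)
  show ?thesis
    using assms(1,2) foldD_insert[of A a \<one>] by (auto simp: finprod_def)
qed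

end

theory Submission
  imports Defs "HOL-Algebra.Group_Action" "HOL-Number_Theory.Cong"
begin

text \<open>
  The element \<open>g\<close> is dominating iff for every \<open>x\<close> some cyclic subgroup contains both \<open>g\<close> and \<open>x\<close>. The argument
  turns this into a condition on elements of prime order: for each prime \<open>p\<close> dividing the order of \<open>g\<close>, the
  whole group has only one subgroup of order \<open>p\<close>, and \<open>g\<close> is central.

  If \<open>g\<close> is dominating, it commutes with everything, and so do its powers \<open>gp p\<close>
  (\<open>primary_part_is_power\<close>). A cyclic group that
  contains \<open>g\<close> and an element \<open>x\<close> of order \<open>p\<close> has only one subgroup of order \<open>p\<close>, so \<open>x\<close> is a power of
  \<open>g\<close>. Hence the Sylow subgroup \<open>P p\<close> has a unique subgroup of order \<open>p\<close>, and a \<open>p\<close>-group with this property is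
  cyclic or generalized quaternion (\<open>p_group_unique_prime_subgroup\<close>). The central \<open>p\<close>-element \<open>gp p\<close> lies in
  \<open>P p\<close>, because some conjugate of it does (\<open>conjugate_into_sylow_subgroup\<close>).

  Conversely, cyclic and generalized quaternion groups have only one subgroup of order \<open>p\<close>. In \<open>P p\<close> it is
  generated by a power of \<open>gp p\<close>, which is central, and by conjugation it is the only subgroup of order \<open>p\<close> of the
  whole group (\<open>unique_prime_subgroup_of_sylow\<close>). As \<open>g\<close> is central, \<open>g\<close> and any \<open>x\<close> generate an abelian
  group. A finite abelian group with at most one subgroup of each prime order is cyclic
  (\<open>cyclic_of_unique_prime_subgroups\<close>), and \<open>cyclic_generated_with_central\<close> verifies this condition for
  the group generated by \<open>g\<close> and \<open>x\<close>.

  The classification of \<open>p\<close>-groups rests on two ingredients. Counting fixed points shows that a maximal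
  abelian normal subgroup \<open>A = \<langle>a\<rangle>\<close> is its own centralizer. A computation of \<open>p\<close>-th powers in a coset
  \<open>A w\<close>, where \<open>w\<close> is outside \<open>A\<close> and \<open>w [^] p\<close> inside, shows that this coset contains a further element
  of order \<open>p\<close>, unless \<open>w\<close> commutes with \<open>a\<close>, or \<open>p = 2\<close> and \<open>w\<close> inverts \<open>a\<close> (\<open>commutes_or_inverts\<close>).
\<close>

section \<open>Elements of prime order\<close>

text \<open>For prime \<open>p\<close> this says that there is at most one subgroup of order \<open>p\<close>. The formulation by
  elements passes to subgroups without change and is what all arguments below use.\<close>

definition unique_prime_subgroup :: "('a, 'b) monoid_scheme \<Rightarrow> nat \<Rightarrow> bool" where
  "unique_prime_subgroup G p \<longleftrightarrow>
     (\<forall>x\<in>carrier G. \<forall>y\<in>carrier G.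
        x [^]\<^bsub>G\<^esub> p = \<one>\<^bsub>G\<^esub> \<longrightarrow> y [^]\<^bsub>G\<^esub> p = \<one>\<^bsub>G\<^esub> \<longrightarrow> y \<noteq> \<one>\<^bsub>G\<^esub> \<longrightarrow> (\<exists>k::nat. x = y [^]\<^bsub>G\<^esub> k))"

context group
begin

lemma pow_subgroup_closed:
  assumes "subgroup H G" "x \<in> H"
  shows "x [^] (n::nat) \<in> H"
  using assms by (induction n) (auto intro: subgroup.m_closed subgroup.one_closed)

lemma pow_eq_iff_cong:
  assumes "x \<in> carrier G"
  shows "x [^] (i::nat) = x [^] j \<longleftrightarrow> [i = j] (mod ord x)"
proof -
  have "x [^] i = x [^] j \<longleftrightarrow> int (ord x) dvd int j - int i"
    using int_pow_eq[OF assms, of "int i" "int j"] by (simp add: int_pow_int)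
  also have "\<dots> \<longleftrightarrow> [i = j] (mod ord x)"
    by (metis cong_iff_dvd_diff cong_int_iff cong_sym_eq)
  finally show ?thesis .
qed

text \<open>The map \<open>x \<mapsto> x [^] m\<close> is invertible on elements whose order divides \<open>n\<close>, because \<open>m\<close> is
  invertible modulo \<open>n\<close>.\<close>

lemma recover_from_coprime_pow:
  assumes x: "x \<in> carrier G" and "x [^] (n::nat) = \<one>" and "coprime m n"
  obtains k :: nat where "(x [^] m) [^] k = x"
proof -
  obtain k where "[m * k = Suc 0] (mod n)"
    using cong_solve_coprime_nat[OF assms(3)] by auto
  moreover have "ord x dvd n"
    using assms pow_eq_id by blast
  ultimately have "[m * k = 1] (mod ord x)"
    using cong_dvd_modulus_nat by auto
  then have "x [^] (m * k) = x"
    using pow_eq_iff_cong[OF x, of "m * k" 1] x by simp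
  then show ?thesis
    using that x by (simp add: nat_pow_pow)
qed

lemma inv_eq_pow:
  assumes "finite (carrier G)" "x \<in> carrier G"
  shows "inv x = x [^] (ord x - 1)"
proof -
  have "x [^] (ord x - 1) \<otimes> x = x [^] (Suc (ord x - 1))"
    by simp
  also have "Suc (ord x - 1) = ord x"
    using ord_ge_1[OF assms] by simp
  finally show ?thesis
    using assms inv_equality by simp
qed

text \<open>Inverses are powers in a finite group, so closure under products is enough.\<close>

lemma finite_submonoid_subgroup:
  assumes "finite (carrier G)" "H \<subseteq> carrier G" "\<one> \<in> H"
    and m: "\<And>x y. x \<in> H \<Longrightarrow> y \<in> H \<Longrightarrow> x \<otimes> y \<in> H"
  shows "subgroup H G"
proof (rule subgroup.intro)
  fix x assume x: "x \<in> H"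
  have "x [^] (n::nat) \<in> H" for n
    by (induction n) (use assms x in auto)
  then show "inv x \<in> H"
    using inv_eq_pow assms x by (metis subsetD)
qed (use assms in auto)

lemma int_pow_eq_nat_pow:
  assumes "finite (carrier G)" "x \<in> carrier G"
  obtains n :: nat where "x [^] (i::int) = x [^] n"
proof -
  have "x [^] i \<in> generate G {x}"
    using generate_pow[OF assms(2)] by auto
  then show ?thesis
    using that generate_pow_on_finite_carrier[OF assms] by auto
qed

text \<open>A cyclic group has at most one subgroup of order \<open>p\<close>. If \<open>ord c = p * m\<close>, then both exponents
  are multiples of \<open>m\<close>, and the cofactor belonging to \<open>y\<close> is invertible modulo \<open>p\<close>. The group generated by
  \<open>c\<close> may be infinite, in which case no such \<open>y\<close> exists.\<close>

lemma power_of_prime_order_element: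
  fixes p i j :: nat
  assumes p: "prime p" and c: "c \<in> carrier G"
    and x: "x = c [^] i" "x [^] p = \<one>"
    and y: "y = c [^] j" "y [^] p = \<one>" "y \<noteq> \<one>"
  obtains k :: nat where "x = y [^] k"
proof -
  let ?n = "ord c"
  have "c [^] (i * p) = \<one>" "c [^] (j * p) = \<one>"
    using x y c by (simp_all add: nat_pow_pow)
  then have dvd: "?n dvd i * p" "?n dvd j * p" "\<not> ?n dvd j"
    using y pow_eq_id[OF c] by blast+
  have "p dvd ?n"
  proof (rule ccontr)
    assume "\<not> p dvd ?n"
    then have "coprime ?n p"
      using p by (metis coprime_commute prime_imp_coprime)
    then have "?n dvd j"
      using dvd(2) coprime_dvd_mult_left_iff by blast
    then show False
      using dvd(3) by simp
  qed
  then obtain m where m: "?n = p * m" by auto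
  have "p \<noteq> 0" using p by auto
  obtain i' j' where ij: "i = m * i'" "j = m * j'"
    using dvd(1,2) \<open>p \<noteq> 0\<close> unfolding m by (metis dvdE dvd_times_left_cancel_iff mult.commute)
  have "\<not> p dvd j'"
    using dvd(3) unfolding m ij by (auto simp: mult.commute mult_dvd_mono)
  then obtain r where r: "[j' * r = 1] (mod p)"
    using cong_solve_coprime_nat[of j' p] p by (metis One_nat_def coprime_commute prime_imp_coprime)
  then have "[j' * r * i' = 1 * i'] (mod p)"
    by (rule cong_scalar_right)
  then have "[m * (j' * r * i') = m * i'] (mod (m * p))"
    by (metis mult_1 cong_cmult_leftI)
  then have "c [^] (j * (r * i')) = c [^] i"
    by (subst pow_eq_iff_cong[OF c]) (simp add: m ij ac_simps)
  then show ?thesis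
    using that[of "r * i'"] x y c by (simp add: nat_pow_pow)
qed

lemma cyclic_group_iff_nat_pow:
  assumes "finite (carrier G)"
  shows "cyclic_group G \<longleftrightarrow> (\<exists>c\<in>carrier G. \<forall>x\<in>carrier G. \<exists>n::nat. x = c [^] n)"
proof
  assume "cyclic_group G"
  then show "\<exists>c\<in>carrier G. \<forall>x\<in>carrier G. \<exists>n::nat. x = c [^] n"
    unfolding cyclic_group using int_pow_eq_nat_pow[OF assms] by (metis imageE)
next
  assume "\<exists>c\<in>carrier G. \<forall>x\<in>carrier G. \<exists>n::nat. x = c [^] n"
  then obtain c where c: "c \<in> carrier G" "\<forall>x\<in>carrier G. \<exists>n::nat. x = c [^] n" by blast
  then have "carrier G = range (\<lambda>n::int. c [^] n)"
    by (auto simp: image_iff) (metis int_pow_int)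
  then show "cyclic_group G"
    unfolding cyclic_group using c by blast
qed

end

section \<open>Cyclic abelian groups\<close>

lemma (in comm_group) ord_dvd_ord_mult_of_coprime:
  assumes x: "x \<in> carrier G" and y: "y \<in> carrier G" and cop: "coprime (ord x) (ord y)"
  shows "ord x dvd ord (x \<otimes> y)"
proof -
  let ?n = "ord (x \<otimes> y) * ord y"
  have "(x \<otimes> y) [^] ?n = \<one>" "y [^] ?n = \<one>"
    using x y pow_eq_id by simp_all
  then have "x [^] ?n = \<one>"
    using x y nat_pow_distrib[OF x y, of ?n] by simp
  then have "ord x dvd ?n"
    using pow_eq_id[OF x] by blast
  then show ?thesis
    using cop coprime_dvd_mult_left_iff by blast
qed

text \<open>An element of maximal order works. If some \<open>ord b\<close> did not divide \<open>ord a\<close>, then \<open>b\<close> would have a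
  larger \<open>p\<close>-part than \<open>a\<close> for some prime \<open>p\<close>; multiplying the \<open>p'\<close>-part of \<open>a\<close> by the \<open>p\<close>-part of \<open>b\<close>
  would give an element of larger order.\<close>

lemma (in comm_group) exists_element_of_exponent_order:
  assumes fin: "finite (carrier G)"
  obtains a where "a \<in> carrier G" "\<And>b. b \<in> carrier G \<Longrightarrow> ord b dvd ord a"
proof -
  have "\<exists>a. a \<in> carrier G \<and> (\<forall>b. b \<in> carrier G \<longrightarrow> ord b \<le> ord a)"
    by (rule ex_has_greatest_nat[of _ \<one> _ "Suc (order G)"]) (use ord_le_group_order[OF fin] in \<open>auto simp: less_Suc_eq_le\<close>)
  then obtain a where a: "a \<in> carrier G" and max: "\<And>b. b \<in> carrier G \<Longrightarrow> ord b \<le> ord a"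
    by blast
  have "ord b dvd ord a" if b: "b \<in> carrier G" for b
  proof (rule ccontr)
    assume nd: "\<not> ord b dvd ord a"
    have nz: "ord a \<noteq> 0" "ord b \<noteq> 0"
      using ord_ge_1[OF fin] a b by (metis not_one_le_zero)+
    then obtain p where p: "prime p" "multiplicity p (ord b) > multiplicity p (ord a)"
      using nd multiplicity_le_imp_dvd by (metis not_le)
    let ?i = "multiplicity p (ord a)" and ?j = "multiplicity p (ord b)"
    obtain m where m: "ord a = p ^ ?i * m" "\<not> p dvd m"
      using multiplicity_decompose'[of "ord a" p] nz p by (metis not_prime_unit)
    obtain n where n: "ord b = p ^ ?j * n" "\<not> p dvd n"
      using multiplicity_decompose'[of "ord b" p] nz p by (metis not_prime_unit)
    have p0: "p \<noteq> 0" using p by auto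
    have mn: "m \<noteq> 0" "n \<noteq> 0" using m n nz by (metis mult_0_right)+
    \<comment> \<open>The part of \<open>a\<close> of order prime to \<open>p\<close>, and the \<open>p\<close>-part of \<open>b\<close>.\<close>
    let ?a = "a [^] (p ^ ?i)" and ?b = "b [^] n"
    have oa: "ord ?a = m"
      using ord_pow[OF a, of "p ^ ?i"] m p0 by (metis dvd_triv_left nonzero_mult_div_cancel_left power_not_zero)
    have ob: "ord ?b = p ^ ?j"
      using ord_pow[OF b, of n] n mn by (metis dvd_triv_right nonzero_mult_div_cancel_right)
    have cop: "coprime m (p ^ ?j)"
      using m(2) p(1) by (metis coprime_commute coprime_power_right_iff prime_imp_coprime)
    let ?c = "?a \<otimes> ?b" 
    have c: "?c \<in> carrier G" using a b by simp
    have "coprime (ord ?a) (ord ?b)" using cop oa ob by simp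
    then have "m dvd ord ?c" "p ^ ?j dvd ord ?c"
      using ord_dvd_ord_mult_of_coprime[of ?a ?b] ord_dvd_ord_mult_of_coprime[of ?b ?a] a b oa ob
      by (simp_all add: m_comm coprime_commute)
    then have "p ^ ?j * m dvd ord ?c"
      using cop by (metis divides_mult mult.commute)
    moreover have "ord ?c \<noteq> 0" using ord_ge_1[OF fin c] by simp
    ultimately have "p ^ ?j * m \<le> ord a"
      using max[OF c] by (meson dvd_imp_le le_trans neq0_conv)
    moreover have "p ^ ?i < p ^ ?j"
      using p by (simp add: prime_gt_Suc_0_nat)
    ultimately show False
      using m(1) mn by (metis mult_less_mono1 leD neq0_conv)
  qed
  with a show ?thesis using that by blast
qed

text \<open>Dividing off the prime factors of \<open>n\<close> one at a time, the power of \<open>b\<close> leaves \<open>H\<close> at some step.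
  For a subgroup \<open>H\<close> of an abelian group this is an element of prime order in the quotient.\<close>

lemma (in group) pow_mem_prime_step:
  fixes n :: nat
  assumes b: "b \<in> carrier G" and "b \<notin> H" "b [^] n \<in> H" "n \<noteq> 0"
  shows "\<exists>q k. prime q \<and> q dvd n \<and> b [^] (k::nat) \<notin> H \<and> (b [^] k) [^] (q::nat) \<in> H"
  using assms(3,4)
proof (induction n rule: less_induct)
  case (less n)
  have "n \<noteq> 1" using less.prems assms(2) b by auto
  then obtain q where q: "prime q" "q dvd n" using prime_factor_nat by blast
  then obtain m where m: "n = q * m" by auto
  have m0: "m \<noteq> 0" "m < n" using less.prems m prime_gt_1_nat[OF q(1)] by auto
  show ?case
  proof (cases "b [^] m \<in> H")
    case True
    then show ?thesis
      using less.IH[OF m0(2) _ m0(1)] m dvd_mult by blast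
  next
    case False
    moreover have "(b [^] m) [^] q \<in> H"
      using less.prems m b by (simp add: nat_pow_pow mult.commute)
    ultimately show ?thesis
      using q by blast
  qed
qed

text \<open>Let \<open>a\<close> have the exponent of the group as its order. An element outside the powers of \<open>a\<close> can be
  replaced by some \<open>d\<close> outside with \<open>d [^] q\<close> a power of \<open>a\<close>. Since the order of \<open>d\<close> divides that of \<open>a\<close>, the
  element \<open>d [^] q\<close> has a \<open>q\<close>-th root among the powers of \<open>a\<close>, and dividing \<open>d\<close> by this root leaves a second
  subgroup of order \<open>q\<close>.\<close>

lemma (in comm_group) cyclic_of_unique_prime_subgroups:
  assumes fin: "finite (carrier G)" and uniq: "\<And>q. prime q \<Longrightarrow> unique_prime_subgroup G q"
  shows "cyclic_group G"
proof -
  obtain a where a: "a \<in> carrier G" and exp: "\<And>b. b \<in> carrier G \<Longrightarrow> ord b dvd ord a"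
    using exists_element_of_exponent_order[OF fin] by blast
  let ?A = "{a [^] k | k. k \<in> (UNIV :: nat set)}"
  have gen: "generate G {a} = ?A"
    using generate_pow_on_finite_carrier[OF fin a] .
  have A: "subgroup ?A G"
    using generate_is_subgroup[of "{a}"] a gen by simp
  have "b \<in> ?A" if b: "b \<in> carrier G" for b
  proof (rule ccontr)
    assume nb: "b \<notin> ?A"
    have "b [^] ord b \<in> ?A" "ord b \<noteq> 0"
      using b subgroup.one_closed[OF A] ord_ge_1[OF fin b] by auto
    then obtain q k where q: "prime q" "q dvd ord b" and k: "b [^] (k::nat) \<notin> ?A" "(b [^] k) [^] q \<in> ?A"
      using pow_mem_prime_step[OF b nb] by blast
    define d where "d = b [^] k"
    have d: "d \<in> carrier G" "d \<notin> ?A" using b k d_def by auto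
    obtain m where m: "d [^] q = a [^] (m::nat)" using k d_def by auto
    have "q dvd ord a" using q exp[OF b] by (rule_tac dvd_trans)
    then obtain e where e: "ord a = q * e" by auto
    have e0: "e \<noteq> 0" "q \<noteq> 0" using e ord_ge_1[OF fin a] by (auto intro: ccontr)
    have "d [^] (q * e) = \<one>" using exp[OF d(1)] pow_eq_id[OF d(1)] e by simp
    then have "a [^] (m * e) = \<one>" using m d a by (metis nat_pow_pow)
    then have "q * e dvd m * e" using pow_eq_id[OF a] e by simp
    then have "q dvd m" using e0 by simp
    then obtain m' where m': "m = m' * q" by (metis dvdE mult.commute)
    define c where "c = d \<otimes> inv (a [^] m')"
    have c: "c \<in> carrier G" using c_def d a by simp
    have "c [^] q = d [^] q \<otimes> inv ((a [^] m') [^] q)"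
      unfolding c_def using d a by (simp add: nat_pow_distrib nat_pow_inv)
    then have cq: "c [^] q = \<one>" using m m' a by (simp add: nat_pow_pow)
    have cA: "c \<notin> ?A"
    proof
      assume "c \<in> ?A"
      moreover have "d = c \<otimes> a [^] m'" unfolding c_def using d a by (simp add: m_assoc)
      ultimately show False using d subgroup.m_closed[OF A] by auto
    qed
    have "(a [^] e) [^] q = \<one>" "a [^] e \<noteq> \<one>"
      using e e0 a pow_eq_id[OF a] prime_gt_1_nat[OF q(1)] by (auto simp: nat_pow_pow mult.commute dest: dvd_imp_le)
    then obtain r :: nat where "c = (a [^] e) [^] r"
      using uniq[OF q(1)] c cq a unfolding unique_prime_subgroup_def by blast
    then show False using cA a by (auto simp: nat_pow_pow)
  qed
  then show ?thesis
    using cyclic_group_iff_nat_pow[OF fin] a by blast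
qed

lemma (in group) restrict_pow [simp]: "x [^]\<^bsub>G\<lparr>carrier := H\<rparr>\<^esub> (n::nat) = x [^] n"
  using nat_pow_consistent by metis

lemma (in group) cyclic_subgroup_of_unique_prime_subgroups:
  assumes H: "subgroup H G" and fin: "finite H"
    and comm: "\<And>x y. x \<in> H \<Longrightarrow> y \<in> H \<Longrightarrow> x \<otimes> y = y \<otimes> x"
    and uniq: "\<And>q. prime q \<Longrightarrow> unique_prime_subgroup (G\<lparr>carrier := H\<rparr>) q"
  shows "cyclic_group (G\<lparr>carrier := H\<rparr>)"
proof -
  interpret H: group "G\<lparr>carrier := H\<rparr>"
    using H by (rule subgroup_imp_group)
  interpret H: comm_group "G\<lparr>carrier := H\<rparr>"
    by unfold_locales (use comm in simp)
  show ?thesis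
    using H.cyclic_of_unique_prime_subgroups fin uniq by simp
qed

section \<open>Fixed points of \<open>p\<close>-groups\<close>

text \<open>Orbit sizes are powers of \<open>p\<close>, so modulo \<open>p\<close> only the orbits of size one count.\<close>

lemma (in group_action) card_fixed_points_cong:
  assumes p: "prime p" and ord: "order G = p ^ n" and fin: "finite E"
  shows "[card E = card {x \<in> E. \<forall>g\<in>carrier G. \<phi> g x = x}] (mod p)"
proof -
  let ?F = "{x \<in> E. \<forall>g\<in>carrier G. \<phi> g x = x}"
  interpret group G using group_hom group_hom.axioms(1) by blast
  have orb_fixed: "orbit G \<phi> x = {x}" if "x \<in> ?F" for x
    using that orbit_refl by (auto simp: orbit_def)
  let ?O = "orbits G E \<phi>"
  have finO: "finite ?O"
    unfolding orbits_def using fin by simp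
  have "card E = (\<Sum>orb\<in>?O. card orb)"
    using disjoint_sum[OF fin, of "\<lambda>_. 1::nat"] by simp
  also have "[(\<Sum>orb\<in>?O. card orb) = (\<Sum>orb\<in>?O. if \<exists>x\<in>?F. orb = {x} then 1 else 0)] (mod p)"
  proof (rule cong_sum)
    fix orb assume "orb \<in> ?O"
    then obtain x where x: "x \<in> E" "orb = orbit G \<phi> x"
      by (auto simp: orbits_def)
    have "card orb dvd p ^ n"
      using orbit_stabilizer_theorem[OF x(1)] x ord by (metis dvd_triv_left)
    then obtain i where i: "card orb = p ^ i"
      using p divides_primepow_nat by blast
    show "[card orb = (if \<exists>x\<in>?F. orb = {x} then 1 else 0)] (mod p)"
    proof (cases "\<exists>x\<in>?F. orb = {x}")
      case True
      then show ?thesis by auto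
    next
      case False
      have "i \<noteq> 0"
      proof
        assume "i = 0"
        then have "orb = {x}"
          using i orbit_refl[OF x(1)] x(2) by (metis card_1_singletonE power_0 singletonD)
        moreover have "x \<in> ?F"
          using \<open>orb = {x}\<close> x by (auto simp: orbit_def)
        ultimately show False using False by blast
      qed
      then show ?thesis
        by (subst if_not_P[OF False]) (simp add: cong_0_iff i)
    qed
  qed
  also have "(\<Sum>orb\<in>?O. if \<exists>x\<in>?F. orb = {x} then 1 else (0::nat)) = card {orb\<in>?O. \<exists>x\<in>?F. orb = {x}}"
    using finO by (simp add: sum.If_cases Int_def)
  also have "{orb\<in>?O. \<exists>x\<in>?F. orb = {x}} = (\<lambda>x. {x}) ` ?F"
    using orb_fixed by (force simp: orbits_def)
  also have "card \<dots> = card ?F"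
    by (rule card_image) auto
  finally show ?thesis .
qed

text \<open>The locale asks for a homomorphism into extensional bijections; restriction to \<open>S\<close> turns an ordinary
  action into one.\<close>

lemma (in group) group_actionI:
  assumes one: "\<And>s. s \<in> S \<Longrightarrow> act \<one> s = s"
    and comp: "\<And>x y s. x \<in> carrier G \<Longrightarrow> y \<in> carrier G \<Longrightarrow> s \<in> S \<Longrightarrow> act (x \<otimes> y) s = act x (act y s)"
    and closed: "\<And>x s. x \<in> carrier G \<Longrightarrow> s \<in> S \<Longrightarrow> act x s \<in> S"
  shows "group_action G S (\<lambda>x. \<lambda>s\<in>S. act x s)"
proof -
  have bij: "(\<lambda>s\<in>S. act x s) \<in> Bij S" if x: "x \<in> carrier G" for x
  proof -
    have "bij_betw (\<lambda>s\<in>S. act x s) S S"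
    proof (rule bij_betw_byWitness[where f' = "act (inv x)"])
      show "\<forall>s\<in>S. act (inv x) ((\<lambda>s\<in>S. act x s) s) = s"
        using x comp[of "inv x" x] one by simp
      show "\<forall>s\<in>S. (\<lambda>s\<in>S. act x s) (act (inv x) s) = s"
        using x comp[of x "inv x"] one closed by simp
    qed (use x closed in auto)
    then show ?thesis by (simp add: Bij_def)
  qed
  have "(\<lambda>x. \<lambda>s\<in>S. act x s) \<in> hom G (BijGroup S)"
    by (rule homI) (auto simp: bij BijGroup_def compose_def comp closed fun_eq_iff)
  then show ?thesis
    by (simp add: group_action_def group_hom_def group_hom_axioms_def group_BijGroup)
qed

lemma (in group) p_group_fixed_points:
  assumes "prime p" "order G = p ^ n" "finite S"
    and one: "\<And>s. s \<in> S \<Longrightarrow> act \<one> s = s"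
    and comp: "\<And>x y s. x \<in> carrier G \<Longrightarrow> y \<in> carrier G \<Longrightarrow> s \<in> S \<Longrightarrow> act (x \<otimes> y) s = act x (act y s)"
    and closed: "\<And>x s. x \<in> carrier G \<Longrightarrow> s \<in> S \<Longrightarrow> act x s \<in> S"
  shows "[card S = card {s \<in> S. \<forall>x\<in>carrier G. act x s = s}] (mod p)"
proof -
  interpret group_action G S "\<lambda>x. \<lambda>s\<in>S. act x s"
    by (rule group_actionI) (use one comp closed in auto)
  have "{s \<in> S. \<forall>x\<in>carrier G. (\<lambda>s\<in>S. act x s) s = s} = {s \<in> S. \<forall>x\<in>carrier G. act x s = s}"
    by auto
  then show ?thesis
    using card_fixed_points_cong[OF assms(1-3)] by simp
qed

text \<open>The \<open>p\<close>-group generated by \<open>x\<close> acts on the right cosets of \<open>P\<close>, whose number is prime to \<open>p\<close>, and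
  hence fixes some coset \<open>P #> h\<close>. This is the part of the second Sylow theorem that is needed.\<close>

lemma (in group) conjugate_into_sylow_subgroup:
  assumes fin: "finite (carrier G)" and syl: "sylow_subgroup G p P"
    and x: "x \<in> carrier G" "x [^] (p ^ k :: nat) = \<one>"
  obtains h where "h \<in> carrier G" "h \<otimes> x \<otimes> inv h \<in> P"
proof -
  have p: "prime p" and P: "subgroup P G" and cardP: "card P = p ^ multiplicity p (order G)"
    using syl by (auto simp: sylow_subgroup_def)
  have PG: "P \<subseteq> carrier G" using subgroup.subset[OF P] .
  let ?Q = "generate G {x}"
  have Q: "subgroup ?Q G" using x by (intro generate_is_subgroup) auto
  then have QG: "?Q \<subseteq> carrier G" by (rule subgroup.subset)
  have xQ: "x \<in> ?Q" by (simp add: generate.incl)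
  interpret Q: group "G\<lparr>carrier := ?Q\<rparr>" using Q by (rule subgroup_imp_group)
  have "ord x dvd p ^ k" using x pow_eq_id by blast
  then obtain i where "ord x = p ^ i" using p divides_primepow_nat by blast
  then have ordQ: "order (G\<lparr>carrier := ?Q\<rparr>) = p ^ i"
    using generate_pow_card[OF x(1)] by (simp add: order_def)
  have og: "order G \<noteq> 0" using fin order_gt_0_iff_finite by auto
  have finS: "finite (rcosets P)" using fin by (simp add: RCOSETS_def)
  have "\<not> p dvd card (rcosets P)"
  proof
    assume "p dvd card (rcosets P)"
    then obtain d where "card (rcosets P) = p * d" ..
    then have "p ^ Suc (multiplicity p (order G)) dvd order G"
      using lagrange[OF P] cardP by (metis dvd_triv_left mult.assoc mult.commute power_Suc)
    then show False
      using p og by (metis Suc_n_not_le_n not_prime_unit power_dvd_iff_le_multiplicity)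
  qed
  moreover let ?F = "{M \<in> rcosets P. \<forall>q\<in>carrier (G\<lparr>carrier := ?Q\<rparr>). M #> inv q = M}"
  have "[card (rcosets P) = card ?F] (mod p)"
  proof (rule Q.p_group_fixed_points[OF p ordQ finS])
    fix M assume "M \<in> rcosets P"
    then obtain h where h: "h \<in> carrier G" "M = P #> h" by (auto simp: RCOSETS_def)
    show "M #> inv \<one>\<^bsub>G\<lparr>carrier := ?Q\<rparr>\<^esub> = M"
      using h PG by (simp add: coset_mult_assoc)
    show "M #> inv (y \<otimes>\<^bsub>G\<lparr>carrier := ?Q\<rparr>\<^esub> z) = M #> inv z #> inv y"
      if "y \<in> carrier (G\<lparr>carrier := ?Q\<rparr>)" "z \<in> carrier (G\<lparr>carrier := ?Q\<rparr>)" for y z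
      using that h PG QG by (simp add: coset_mult_assoc inv_mult_group subset_iff m_assoc)
    show "M #> inv y \<in> rcosets P" if "y \<in> carrier (G\<lparr>carrier := ?Q\<rparr>)" for y
      using that h PG QG by (auto simp: coset_mult_assoc subset_iff intro!: rcosetsI)
  qed
  ultimately have "?F \<noteq> {}"
    by (metis card.empty cong_0_iff)
  then obtain M where M: "M \<in> rcosets P" "M #> inv x = M"
    using xQ by auto
  then obtain h where h: "h \<in> carrier G" "M = P #> h" by (auto simp: RCOSETS_def)
  then have "P #> (h \<otimes> inv x) = P #> h"
    using M x PG by (simp add: coset_mult_assoc)
  then have "h \<otimes> inv x \<in> P #> h"
    using rcos_self[OF _ P, of "h \<otimes> inv x"] h x by auto
  then have "h \<otimes> inv x \<otimes> inv h \<in> P"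
    using subgroup.rcos_module_imp[OF P] h is_group by blast
  then have "inv (h \<otimes> inv x \<otimes> inv h) \<in> P"
    using P by (rule_tac subgroup.m_inv_closed)
  then have "h \<otimes> x \<otimes> inv h \<in> P"
    using h x by (simp add: inv_mult_group m_assoc)
  then show ?thesis using that h by blast
qed

text \<open>In other words, the nontrivial normal subgroup \<open>C / A\<close> of the \<open>p\<close>-group \<open>G / A\<close> contains a
  nontrivial central element: conjugation acts on the \<open>p\<close>-power many cosets of \<open>A\<close> in \<open>C\<close> and fixes the
  coset \<open>A\<close>, so it fixes another one.\<close>

lemma (in group) exists_central_coset:
  assumes p: "prime p" and ordG: "order G = p ^ n"
    and A: "A \<lhd> G" and C: "C \<lhd> G" and sub: "A \<subset> C"
  obtains x where "x \<in> C" "x \<notin> A" "\<And>h. h \<in> carrier G \<Longrightarrow> h \<otimes> x \<otimes> inv h \<in> A #> x"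
proof -
  interpret A: normal A G by fact
  interpret C: normal C G by fact
  have fin: "finite (carrier G)"
    using ordG p by (metis not_prime_0 order_gt_0_iff_finite power_eq_0_iff neq0_conv)
  have AG: "A \<subseteq> carrier G" and CG: "C \<subseteq> carrier G" by (rule A.subset C.subset)+
  define S where "S = (\<lambda>c. A #> c) ` C"
  define act where "act h M = (\<lambda>m. h \<otimes> m \<otimes> inv h) ` M" for h M
  have conj: "\<And>h a. h \<in> carrier G \<Longrightarrow> a \<in> A \<Longrightarrow> h \<otimes> a \<otimes> inv h \<in> A"
    using A.inv_op_closed2 by blast
  have act_coset: "act h (A #> c) = A #> (h \<otimes> c \<otimes> inv h)" if "h \<in> carrier G" "c \<in> C" for h c
  proof
    have c: "c \<in> carrier G" using that CG by auto
    have eq: "h \<otimes> (a \<otimes> c) \<otimes> inv h = (h \<otimes> a \<otimes> inv h) \<otimes> (h \<otimes> c \<otimes> inv h)" if "a \<in> A" for a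
      using that \<open>h \<in> carrier G\<close> c AG by (simp add: m_assoc subset_iff inv_solve_left)
    show "act h (A #> c) \<subseteq> A #> (h \<otimes> c \<otimes> inv h)"
      using eq conj[OF that(1)] by (force simp: act_def r_coset_def)
    show "A #> (h \<otimes> c \<otimes> inv h) \<subseteq> act h (A #> c)"
    proof
      fix y assume "y \<in> A #> (h \<otimes> c \<otimes> inv h)"
      then obtain a where a: "a \<in> A" "y = a \<otimes> (h \<otimes> c \<otimes> inv h)" by (auto simp: r_coset_def)
      let ?a = "inv h \<otimes> a \<otimes> h"
      have a': "?a \<in> A" using A.inv_op_closed1 that a by blast
      have "a \<in> carrier G" using a AG by auto
      moreover from this have "h \<otimes> (inv h \<otimes> a) = a" using that by (simp add: m_assoc[symmetric])
      ultimately have "h \<otimes> ?a \<otimes> inv h = a" using that by (simp add: m_assoc)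
      then have "y = h \<otimes> (?a \<otimes> c) \<otimes> inv h" using eq[OF a'] a by simp
      then show "y \<in> act h (A #> c)" using a' by (auto simp: act_def r_coset_def)
    qed
  qed
  interpret CC: group "G\<lparr>carrier := C\<rparr>" by (rule subgroup_imp_group) unfold_locales
  have AC: "subgroup A (G\<lparr>carrier := C\<rparr>)"
    by (rule subgroup_incl) (use sub in \<open>auto intro: A.subgroup_axioms C.subgroup_axioms\<close>)
  have "rcosets\<^bsub>G\<lparr>carrier := C\<rparr>\<^esub> A = S"
    by (auto simp: S_def RCOSETS_def r_coset_def)
  then have "card S * card A = card C"
    using CC.lagrange[OF AC] by (simp add: order_def)
  moreover have finC: "finite C" using CG fin by (rule finite_subset)
  have "card A < card C" using sub finC by (simp add: psubset_card_mono)
  ultimately have S1: "card S \<noteq> 1" by auto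
  have "card C dvd p ^ n" using lagrange[OF C.subgroup_axioms] ordG by (metis dvd_triv_right)
  then have "card S dvd p ^ n"
    using \<open>card S * card A = card C\<close> by (metis dvd_mult_left)
  then obtain i where "card S = p ^ i" using p divides_primepow_nat by blast
  then have pS: "p dvd card S" using S1 by (cases i) auto
  let ?F = "{M \<in> S. \<forall>h\<in>carrier G. act h M = M}"
  have finS: "finite S" using finC by (simp add: S_def)
  have "[card S = card ?F] (mod p)"
  proof (rule p_group_fixed_points[OF p ordG finS])
    fix M assume "M \<in> S"
    then obtain c where c: "c \<in> C" "M = A #> c" by (auto simp: S_def)
    have cG: "c \<in> carrier G" using c CG by auto
    show "act \<one> M = M" using c act_coset[of \<one> c] cG by simp
    show "act h M \<in> S" if "h \<in> carrier G" for h
      using act_coset[OF that c(1)] C.inv_op_closed2[OF that c(1)] c by (simp add: S_def)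
    show "act (h \<otimes> k) M = act h (act k M)" if "h \<in> carrier G" "k \<in> carrier G" for h k
      using that c cG C.inv_op_closed2[OF that(2) c(1)]
      by (simp add: act_coset inv_mult_group m_assoc)
  qed
  then have pF: "p dvd card ?F" using pS by (rule cong_dvd_iff[THEN iffD1])
  have "A \<in> ?F"
  proof -
    have A1: "A #> \<one> = A" using AG by (rule coset_mult_one)
    have "act h A = A" if "h \<in> carrier G" for h
      using act_coset[OF that C.one_closed] A1 that by simp
    then show ?thesis
      using A1 C.one_closed unfolding S_def by (auto simp: image_iff intro!: bexI[of _ \<one>])
  qed
  have "card ?F \<noteq> 1" using pF p by auto
  then have "?F \<noteq> {A}" by (metis is_singletonI is_singleton_altdef)
  then obtain M where M: "M \<in> ?F" "M \<noteq> A" using \<open>A \<in> ?F\<close> by blast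
  then obtain x where x: "x \<in> C" "M = A #> x" by (auto simp: S_def)
  have xG: "x \<in> carrier G" using x CG by auto
  have "x \<notin> A" using M x A.rcos_const[OF is_group] by blast
  moreover have "h \<otimes> x \<otimes> inv h \<in> A #> x" if "h \<in> carrier G" for h
  proof -
    have "x \<in> M" using x rcos_self[OF xG A.subgroup_axioms] by simp
    then have "h \<otimes> x \<otimes> inv h \<in> act h M" by (simp add: act_def)
    then show ?thesis using M that x by simp
  qed
  ultimately show ?thesis using that x by blast
qed

section \<open>Powers of a product that normalizes a cyclic subgroup\<close>

text \<open>Writing \<open>u = 1 + p * v\<close>, the sum is congruent to \<open>p + p * v * (p * (p - 1) / 2)\<close> modulo \<open>p ^ 2\<close>,
  and \<open>(p - 1) / 2\<close> is an integer for odd \<open>p\<close>.\<close>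

lemma geometric_sum_mod_prime_square:
  fixes u :: int
  assumes p: "prime p" "odd p" and u: "int p dvd u - 1"
  shows "\<not> int (p ^ 2) dvd (\<Sum>j<p. u ^ j)"
proof -
  obtain v where v: "u = 1 + int p * v" using u by (metis dvdE diff_add_cancel add.commute)
  have pow: "[u ^ j = 1 + int j * (int p * v)] (mod int (p ^ 2))" for j
  proof (induction j)
    case (Suc j)
    have "[u * u ^ j = u * (1 + int j * (int p * v))] (mod int (p ^ 2))"
      by (rule cong_scalar_left[OF Suc])
    also have "u * (1 + int j * (int p * v)) = 1 + int (Suc j) * (int p * v) + int (p ^ 2) * (int j * v ^ 2)"
      by (simp add: v algebra_simps power2_eq_square)
    also have "[\<dots> = 1 + int (Suc j) * (int p * v)] (mod int (p ^ 2))"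
      by (simp add: cong_def)
    finally show ?case by simp
  qed simp
  have "[(\<Sum>j<p. u ^ j) = (\<Sum>j<p. 1 + int j * (int p * v))] (mod int (p ^ 2))"
    by (rule cong_sum) (rule pow)
  also have "(\<Sum>j<p. 1 + int j * (int p * v)) = int p + (\<Sum>j<p. int j) * (int p * v)"
    by (simp add: sum.distrib sum_distrib_right)
  also have "(\<Sum>j<p. int j) = int p * int ((p - 1) div 2)"
  proof -
    obtain r where r: "p = 2 * r + 1" using p(2) by (rule oddE)
    have "2 * (\<Sum>j<p. int j) = int p * (int p - 1)" for p :: nat
      by (induction p) (simp_all add: algebra_simps)
    from this[of p] show ?thesis by (simp add: r algebra_simps)
  qed
  also have "int p + int p * int ((p - 1) div 2) * (int p * v) = int p + int (p ^ 2) * (int ((p - 1) div 2) * v)"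
    by (simp add: power2_eq_square)
  also have "[\<dots> = int p] (mod int (p ^ 2))"
    by (simp add: cong_def)
  finally have "[(\<Sum>j<p. u ^ j) = int p] (mod int (p ^ 2))" .
  moreover have "\<not> int (p ^ 2) dvd int p"
    using p(1) prime_gt_1_nat[OF p(1)] by (simp add: power2_eq_square nat_dvd_not_less del: of_nat_mult of_nat_power)
  ultimately show ?thesis
    using cong_dvd_iff by metis
qed

text \<open>In the application, \<open>a\<close> has order \<open>p ^ m\<close>, conjugation by \<open>w\<close> raises \<open>a\<close> to the power \<open>u\<close>, and
  \<open>w [^] p = a [^] s\<close>. A solution \<open>i\<close> of the congruence is an exponent for which \<open>a [^] i \<otimes> w\<close> has trivial
  \<open>p\<close>-th power. Such a solution exists as soon as the greatest common divisor of the geometric sum and \<open>p ^ m\<close>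
  divides \<open>s\<close>. As \<open>u\<close> is not \<open>1\<close> modulo \<open>p ^ m\<close>, the prime
  \<open>p\<close> divides \<open>s\<close>, so this can fail only if \<open>p ^ 2\<close> divides the sum; that leaves \<open>p = 2\<close> with
  \<open>u\<close> congruent to \<open>3\<close> modulo \<open>4\<close>, where \<open>s\<close> is a multiple of \<open>2 ^ (m - 1)\<close> and only \<open>u = -1\<close> remains.\<close>

lemma no_solution_imp_inversion:
  fixes u s :: int
  assumes p: "prime p"
    and fix_s: "int p ^ m dvd (u - 1) * s"
    and nosol: "\<And>i. \<not> int p ^ m dvd i * (\<Sum>j<p. u ^ j) + s"
    and u1: "\<not> int p ^ m dvd u - 1"
  shows "p = 2 \<and> 2 ^ m dvd u + 1 \<and> (\<exists>r. m = Suc r \<and> 2 ^ r dvd s)"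
proof -
  let ?N = "\<Sum>j<p. u ^ j"
  have pi: "prime (int p)" using p by simp
  have solvable: "\<not> gcd ?N (int p ^ m) dvd s"
  proof
    assume "gcd ?N (int p ^ m) dvd s"
    then have "gcd ?N (int p ^ m) dvd - s" by simp
    then obtain i where "[?N * i = - s] (mod int p ^ m)"
      using cong_solve_dvd_int by metis
    then have "int p ^ m dvd i * ?N + s"
      by (simp add: cong_iff_dvd_diff mult.commute)
    then show False using nosol by blast
  qed
  have "gcd ?N (int p ^ m) dvd int p ^ m" by simp
  then obtain l where l: "l \<le> m" "gcd ?N (int p ^ m) = int p ^ l"
    using divides_primepow[OF pi, of "gcd ?N (int p ^ m)" m] by auto
  have ps: "int p dvd s"
  proof (rule ccontr)
    assume "\<not> int p dvd s"
    then have "coprime (int p ^ m) s" using pi by (simp add: prime_imp_coprime)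
    then show False using fix_s u1 coprime_dvd_mult_left_iff by blast
  qed
  have pu: "int p dvd u - 1"
  proof (rule ccontr)
    assume "\<not> int p dvd u - 1"
    then have "coprime (int p ^ m) (u - 1)" using pi by (simp add: prime_imp_coprime)
    then have "int p ^ m dvd s" using fix_s coprime_dvd_mult_right_iff by blast
    then show False using nosol[of 0] by simp
  qed
  have l2: "2 \<le> l"
  proof (rule ccontr)
    assume "\<not> 2 \<le> l"
    then have "l = 0 \<or> l = 1" by auto
    then have "int p ^ l dvd s" using ps by auto
    then show False using solvable l by simp
  qed
  then have "int (p ^ 2) dvd ?N"
    using l by (metis gcd_dvd1 le_imp_power_dvd of_nat_power dvd_trans)
  then have p2: "p = 2"
    using geometric_sum_mod_prime_square[OF p _ pu] prime_odd_nat[OF p] prime_ge_2_nat[OF p]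
    by (metis le_neq_implies_less)
  have N: "?N = u + 1" unfolding p2 by (simp add: numeral_2_eq_2)
  have "4 dvd u + 1" using \<open>int (p ^ 2) dvd ?N\<close> unfolding N by (simp add: p2)
  then have "odd ((u - 1) div 2)" "u - 1 = 2 * ((u - 1) div 2)" by presburger+
  then have cop: "coprime (2 ^ k) ((u - 1) div 2)" for k by simp
  obtain r where r: "m = Suc r" using l l2 by (cases m) auto
  have "2 * 2 ^ r dvd 2 * (((u - 1) div 2) * s)"
    using fix_s \<open>u - 1 = 2 * ((u - 1) div 2)\<close> unfolding p2 r by (metis mult.assoc power_Suc of_nat_numeral)
  then have "2 ^ r dvd ((u - 1) div 2) * s" by simp
  then have s: "2 ^ r dvd s" using cop[of r] coprime_dvd_mult_right_iff by blast
  have "l = m"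
  proof (rule ccontr)
    assume "l \<noteq> m"
    then have "(2::int) ^ l dvd 2 ^ r" using l r by (simp add: le_imp_power_dvd)
    then show False using solvable l(2) s unfolding p2 by (metis dvd_trans of_nat_numeral)
  qed
  then have "int p ^ m dvd ?N" using l(2) by (metis gcd_dvd1)
  then have "2 ^ m dvd u + 1" unfolding N by (simp add: p2)
  then show ?thesis using p2 r s by blast
qed

context group
begin

lemma conj_mult:
  assumes "h \<in> carrier G" "x \<in> carrier G" "y \<in> carrier G"
  shows "h \<otimes> (x \<otimes> y) \<otimes> inv h = (h \<otimes> x \<otimes> inv h) \<otimes> (h \<otimes> y \<otimes> inv h)"
proof -
  have "inv h \<otimes> (h \<otimes> (y \<otimes> inv h)) = y \<otimes> inv h"
    using assms by (simp add: m_assoc[symmetric])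
  then show ?thesis using assms by (simp add: m_assoc)
qed

lemma conj_pow:
  assumes "h \<in> carrier G" "x \<in> carrier G"
  shows "h \<otimes> x [^] (k::nat) \<otimes> inv h = (h \<otimes> x \<otimes> inv h) [^] k"
proof (induction k)
  case (Suc k)
  have "h \<otimes> x [^] Suc k \<otimes> inv h = (h \<otimes> x [^] k \<otimes> inv h) \<otimes> (h \<otimes> x \<otimes> inv h)"
    using assms by (simp add: conj_mult)
  then show ?case using Suc by simp
qed (use assms in simp)

lemma skew_commute_pow:
  assumes a: "a \<in> carrier G" and w: "w \<in> carrier G" and skew: "w \<otimes> a = a [^] (u::nat) \<otimes> w"
  shows "w \<otimes> a [^] (i::nat) = a [^] (u * i) \<otimes> w"
proof (induction i)
  case (Suc i)
  have "w \<otimes> a [^] Suc i = (w \<otimes> a [^] i) \<otimes> a" using a w by (simp add: m_assoc)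
  also have "\<dots> = a [^] (u * i) \<otimes> (w \<otimes> a)" using Suc a w by (simp add: m_assoc)
  also have "\<dots> = a [^] (u * i) \<otimes> a [^] u \<otimes> w" using skew a w by (simp add: m_assoc)
  also have "\<dots> = a [^] (u * Suc i) \<otimes> w" using a by (simp add: nat_pow_mult add.commute)
  finally show ?case .
qed (use w in simp)

text \<open>Moving all factors \<open>w\<close> to the right turns the exponent of \<open>a\<close> into a geometric sum.\<close>

lemma skew_mult_pow:
  assumes a: "a \<in> carrier G" and w: "w \<in> carrier G" and skew: "w \<otimes> a = a [^] (u::nat) \<otimes> w"
  shows "(a [^] (i::nat) \<otimes> w) [^] k = a [^] (i * (\<Sum>j<k. u ^ j)) \<otimes> w [^] k"
proof (induction k)
  case (Suc k)
  let ?S = "\<Sum>j<k. u ^ j"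
  have "(a [^] i \<otimes> w) [^] Suc k = a [^] i \<otimes> w \<otimes> (a [^] i \<otimes> w) [^] k"
    using a w by (metis m_closed nat_pow_Suc2 nat_pow_closed)
  also have "\<dots> = a [^] i \<otimes> (w \<otimes> a [^] (i * ?S)) \<otimes> w [^] k"
    using Suc a w by (simp add: m_assoc)
  also have "w \<otimes> a [^] (i * ?S) = a [^] (u * (i * ?S)) \<otimes> w"
    by (rule skew_commute_pow[OF a w skew])
  also have "a [^] i \<otimes> (a [^] (u * (i * ?S)) \<otimes> w) \<otimes> w [^] k =
      (a [^] i \<otimes> a [^] (u * (i * ?S))) \<otimes> (w \<otimes> w [^] k)"
    using a w by (simp add: m_assoc)
  also have "\<dots> = a [^] (i + u * (i * ?S)) \<otimes> w [^] Suc k"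
    using a w by (metis nat_pow_mult nat_pow_Suc2)
  also have "i + u * (i * ?S) = i * (\<Sum>j<Suc k. u ^ j)"
    by (simp add: sum.lessThan_Suc_shift sum_distrib_left algebra_simps del: sum.lessThan_Suc)
  finally show ?case .
qed (use w in simp)

text \<open>Suppose that the extension of \<open>\<langle>a\<rangle>\<close> by \<open>w\<close> has no element of the coset \<open>\<langle>a\<rangle>w\<close> with trivial
  \<open>p\<close>-th power. Then it is abelian or generalized quaternion; in the latter case \<open>w [^] 2\<close> is the unique involution
  of \<open>\<langle>a\<rangle>\<close>, because it is a nontrivial power of \<open>a\<close> whose exponent is a multiple of half the order.\<close>

lemma commutes_or_inverts:
  assumes p: "prime p" and a: "a \<in> carrier G" and w: "w \<in> carrier G"
    and orda: "ord a = p ^ m"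
    and skew: "w \<otimes> a = a [^] (u::nat) \<otimes> w"
    and wp: "w [^] p = a [^] (s::nat)"
    and no: "\<And>i::nat. (a [^] i \<otimes> w) [^] p \<noteq> \<one>"
  shows "w \<otimes> a = a \<otimes> w \<or>
    p = 2 \<and> w \<otimes> a = inv a \<otimes> w \<and> (\<exists>r. m = Suc r \<and> w [^] (2::nat) = a [^] (2 ^ r :: nat))"
proof (subst disj_commute, rule disjCI)
  assume nc: "w \<otimes> a \<noteq> a \<otimes> w"
  have p0: "p > 0" using p prime_gt_0_nat by blast
  have "a [^] (u * s) \<otimes> w = w \<otimes> w [^] p"
    using skew_commute_pow[OF a w skew, of s] wp by simp
  also have "\<dots> = a [^] s \<otimes> w" using w wp by (metis nat_pow_Suc nat_pow_Suc2)
  finally have "a [^] (u * s) = a [^] s" using a w by simp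
  then have "[u * s = s] (mod p ^ m)" using pow_eq_iff_cong[OF a] orda by simp
  then have fix_s: "int p ^ m dvd (int u - 1) * int s"
    by (metis (no_types, opaque_lifting) cong_iff_dvd_diff cong_int_iff left_diff_distrib mult_1 of_nat_mult of_nat_power)
  have nosol: "\<not> int p ^ m dvd i * (\<Sum>j<p. int u ^ j) + int s" for i
  proof
    assume dvd: "int p ^ m dvd i * (\<Sum>j<p. int u ^ j) + int s"
    define i' where "i' = nat (i mod int p ^ m)"
    have i': "int i' = i mod int p ^ m" using p0 by (simp add: i'_def)
    have "[int i' * (\<Sum>j<p. int u ^ j) + int s = i * (\<Sum>j<p. int u ^ j) + int s] (mod int p ^ m)"
      unfolding i' by (intro cong_add cong_mult) (simp_all add: cong_def)
    then have "int p ^ m dvd int i' * (\<Sum>j<p. int u ^ j) + int s"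
      using dvd cong_dvd_iff by blast
    then have "int (p ^ m) dvd int (i' * (\<Sum>j<p. u ^ j) + s)" by simp
    then have "ord a dvd i' * (\<Sum>j<p. u ^ j) + s" using orda int_dvd_int_iff by metis
    then have "a [^] (i' * (\<Sum>j<p. u ^ j) + s) = \<one>" using pow_eq_id[OF a] by blast
    then have "(a [^] i' \<otimes> w) [^] p = \<one>"
      using skew_mult_pow[OF a w skew, of i' p] wp a by (simp add: nat_pow_mult)
    then show False using no by blast
  qed
  have "\<not> int p ^ m dvd int u - 1"
  proof
    assume "int p ^ m dvd int u - 1"
    then have "[u = 1] (mod ord a)"
      unfolding orda by (metis cong_iff_dvd_diff cong_int_iff of_nat_1 of_nat_power)
    then have "a [^] u = a" using pow_eq_iff_cong[OF a, of u 1] a by simp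
    then show False using skew nc by simp
  qed
  from no_solution_imp_inversion[OF p fix_s nosol this]
  obtain r where r: "p = 2" "2 ^ m dvd int u + 1" "m = Suc r" "2 ^ r dvd int s" by blast
  have "int (2 ^ m) dvd int (u + 1)" using r(2) by (simp add: add.commute)
  then have "ord a dvd u + 1" unfolding orda r(1) using int_dvd_int_iff by blast
  then have "a [^] (u + 1) = \<one>" using pow_eq_id[OF a] by blast
  then have "a [^] u \<otimes> a = \<one>" by simp
  then have "a [^] u = inv a" using a by (metis inv_equality inv_inv nat_pow_closed)
  moreover have "a [^] s = a [^] (2 ^ r :: nat)"
  proof -
    have "int (2 ^ r) dvd int s" using r(4) by simp
    then have "2 ^ r dvd s" using int_dvd_int_iff by blast
    then obtain t where t: "s = 2 ^ r * t" ..
    have "odd t"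
    proof
      assume "even t"
      then have "2 ^ m dvd s" unfolding t r(3) by (auto simp: mult_dvd_mono)
      then have "int p ^ m dvd int s" unfolding r(1) by (metis int_dvd_int_iff of_nat_power)
      then show False using nosol[of 0] by simp
    qed
    then obtain t' where "t = 2 * t' + 1" by (rule oddE)
    then have "s = 2 ^ r + ord a * t'" unfolding t orda r(1,3) by simp
    then show ?thesis using pow_eq_iff_cong[OF a] by (simp add: cong_def)
  qed
  ultimately show "p = 2 \<and> w \<otimes> a = inv a \<otimes> w \<and> (\<exists>r. m = Suc r \<and> w [^] (2::nat) = a [^] (2 ^ r :: nat))"
    using r wp skew by metis
qed

section \<open>\<open>p\<close>-groups with at most one subgroup of order \<open>p\<close>\<close>

text \<open>If the centralizer \<open>C\<close> of \<open>A\<close> were larger than \<open>A\<close>, it would contain an element \<open>x\<close> outside \<open>A\<close>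
  that is central modulo \<open>A\<close>. Then \<open>A\<close> and \<open>x\<close> together generate a larger abelian normal subgroup.\<close>

lemma maximal_abelian_normal_self_centralizing:
  assumes p: "prime p" and ordG: "order G = p ^ n"
    and A: "A \<lhd> G" and abel: "\<And>x y. x \<in> A \<Longrightarrow> y \<in> A \<Longrightarrow> x \<otimes> y = y \<otimes> x"
    and max: "\<And>B. B \<lhd> G \<Longrightarrow> (\<And>x y. x \<in> B \<Longrightarrow> y \<in> B \<Longrightarrow> x \<otimes> y = y \<otimes> x) \<Longrightarrow> card B \<le> card A"
    and c: "c \<in> carrier G" "\<And>a. a \<in> A \<Longrightarrow> c \<otimes> a = a \<otimes> c"
  shows "c \<in> A"
proof (rule ccontr)
  assume cA: "c \<notin> A"
  interpret A: normal A G by fact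
  have AG: "A \<subseteq> carrier G" by (rule A.subset)
  have fin: "finite (carrier G)"
    using ordG p by (metis not_prime_0 order_gt_0_iff_finite power_eq_0_iff neq0_conv)
  define C where "C = {x \<in> carrier G. \<forall>a\<in>A. x \<otimes> a = a \<otimes> x}"
  have "subgroup C G"
  proof (rule finite_submonoid_subgroup[OF fin])
    fix x y assume "x \<in> C" "y \<in> C"
    then have xy: "x \<in> carrier G" "y \<in> carrier G"
      and comm: "\<And>a. a \<in> A \<Longrightarrow> x \<otimes> a = a \<otimes> x" "\<And>a. a \<in> A \<Longrightarrow> y \<otimes> a = a \<otimes> y"
      by (auto simp: C_def)
    have "x \<otimes> y \<otimes> a = a \<otimes> (x \<otimes> y)" if a: "a \<in> A" for a
    proof -
      have "a \<in> carrier G" using a AG by auto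
      then have "x \<otimes> y \<otimes> a = x \<otimes> a \<otimes> y" using xy comm(2)[OF a] by (simp add: m_assoc)
      then show ?thesis using xy comm(1)[OF a] \<open>a \<in> carrier G\<close> by (simp add: m_assoc)
    qed
    then show "x \<otimes> y \<in> C" using xy by (simp add: C_def)
  qed (use AG in \<open>auto simp: C_def\<close>)
  moreover have "h \<otimes> x \<otimes> inv h \<in> C" if h: "h \<in> carrier G" and x: "x \<in> C" for h x
  proof -
    have xG: "x \<in> carrier G" using x C_def by auto
    have "h \<otimes> x \<otimes> inv h \<otimes> a = a \<otimes> (h \<otimes> x \<otimes> inv h)" if a: "a \<in> A" for a
    proof -
      define b where "b = inv h \<otimes> a \<otimes> h"
      have b: "b \<in> A" "b \<in> carrier G" using A.inv_op_closed1 h a AG b_def by auto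
      have aG: "a \<in> carrier G" using a AG by auto
      have ab: "a = h \<otimes> b \<otimes> inv h"
        unfolding b_def using h aG by (metis inv_closed inv_solve_left inv_solve_right m_assoc m_closed)
      have "x \<otimes> b = b \<otimes> x" using x b C_def by auto
      then have "h \<otimes> (x \<otimes> b) \<otimes> inv h = h \<otimes> (b \<otimes> x) \<otimes> inv h" by simp
      then show ?thesis
        unfolding ab using h xG b by (simp add: conj_mult)
    qed
    then show ?thesis using h xG by (simp add: C_def)
  qed
  ultimately have C: "C \<lhd> G" by (simp add: normal_inv_iff)
  have "A \<subset> C" using AG abel c cA by (auto simp: C_def)
  then obtain x where x: "x \<in> C" "x \<notin> A" "\<And>h. h \<in> carrier G \<Longrightarrow> h \<otimes> x \<otimes> inv h \<in> A #> x"
    using exists_central_coset[OF p ordG A C] by blast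
  have xG: "x \<in> carrier G" and xa: "\<And>a. a \<in> A \<Longrightarrow> x \<otimes> a = a \<otimes> x" using x C_def by auto
  have xka: "x [^] (k::nat) \<otimes> a = a \<otimes> x [^] k" if "a \<in> A" for a k
    using group_commutes_pow[OF xa[OF that] xG] that AG by auto
  define B where "B = {a \<otimes> x [^] (k::nat) | a k. a \<in> A}"
  have mult: "(a \<otimes> x [^] (k::nat)) \<otimes> (b \<otimes> x [^] (l::nat)) = (a \<otimes> b) \<otimes> x [^] (k + l)"
    if "a \<in> A" "b \<in> A" for a b k l
  proof -
    have G: "a \<in> carrier G" "b \<in> carrier G" using that AG by auto
    have "(a \<otimes> x [^] k) \<otimes> (b \<otimes> x [^] l) = a \<otimes> (x [^] k \<otimes> b) \<otimes> x [^] l"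
      using G xG by (simp add: m_assoc)
    also have "\<dots> = (a \<otimes> b) \<otimes> (x [^] k \<otimes> x [^] l)"
      using G xG xka[OF that(2)] by (simp add: m_assoc)
    finally show ?thesis using xG by (simp add: nat_pow_mult)
  qed
  have BG: "B \<subseteq> carrier G" using AG xG by (auto simp: B_def)
  have AB: "A \<subseteq> B"
  proof
    fix a assume "a \<in> A"
    then have "a = a \<otimes> x [^] (0::nat)" using AG by auto
    then show "a \<in> B" using \<open>a \<in> A\<close> unfolding B_def by blast
  qed
  have "x = \<one> \<otimes> x [^] (1::nat)" using xG by simp
  then have xB: "x \<in> B" using A.one_closed unfolding B_def by blast
  have sB: "subgroup B G"
  proof (rule finite_submonoid_subgroup[OF fin BG])
    show "\<one> \<in> B" using AB by auto
    fix y z assume "y \<in> B" "z \<in> B"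
    then obtain a b k l where "a \<in> A" "y = a \<otimes> x [^] (k::nat)" "b \<in> A" "z = b \<otimes> x [^] (l::nat)"
      by (auto simp: B_def)
    then show "y \<otimes> z \<in> B" using mult A.m_closed unfolding B_def by blast
  qed
  have comm: "y \<otimes> z = z \<otimes> y" if "y \<in> B" "z \<in> B" for y z
    using that unfolding B_def by (auto simp: mult abel add.commute)
  have "h \<otimes> y \<otimes> inv h \<in> B" if h: "h \<in> carrier G" and y: "y \<in> B" for h y
  proof -
    obtain a k where ak: "a \<in> A" "y = a \<otimes> x [^] (k::nat)" using y by (auto simp: B_def)
    have aG: "a \<in> carrier G" using ak AG by auto
    have "h \<otimes> y \<otimes> inv h = (h \<otimes> a \<otimes> inv h) \<otimes> (h \<otimes> x [^] k \<otimes> inv h)"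
      using ak aG h xG by (simp add: conj_mult)
    also have "h \<otimes> x [^] k \<otimes> inv h = (h \<otimes> x \<otimes> inv h) [^] k"
      by (rule conj_pow[OF h xG])
    finally have eq: "h \<otimes> y \<otimes> inv h = (h \<otimes> a \<otimes> inv h) \<otimes> (h \<otimes> x \<otimes> inv h) [^] k" .
    obtain a' where "a' \<in> A" "h \<otimes> x \<otimes> inv h = a' \<otimes> x" using x(3)[OF h] by (auto simp: r_coset_def)
    then have "h \<otimes> x \<otimes> inv h \<in> B"
      using subgroup.m_closed[OF sB] AB xB by auto
    then have "(h \<otimes> x \<otimes> inv h) [^] k \<in> B" by (rule pow_subgroup_closed[OF sB])
    then show ?thesis
      unfolding eq using subgroup.m_closed[OF sB] AB A.inv_op_closed2[OF h ak(1)] by blast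
  qed
  with sB have "B \<lhd> G" by (simp add: normal_inv_iff)
  then have "card B \<le> card A" using max comm by blast
  moreover have "card A < card B"
    by (rule psubset_card_mono) (use AB xB x(2) fin BG finite_subset in blast)+
  ultimately show False by simp
qed

text \<open>This is the classical description of the \<open>p\<close>-groups with a unique subgroup of order \<open>p\<close>. Let \<open>A\<close>
  be a maximal abelian normal subgroup. It is cyclic, say \<open>A = \<langle>a\<rangle>\<close>, and equals its own centralizer. Let
  \<open>A \<noteq> G\<close>. An element outside \<open>A\<close> with its \<open>p\<close>-th power in \<open>A\<close> does not commute with \<open>a\<close>, hence \<open>p = 2\<close> and it inverts \<open>a\<close>. As
  inversion is not the square of an automorphism of \<open>A\<close>, every element outside \<open>A\<close> has its square
  in \<open>A\<close>. So all elements outside \<open>A\<close> invert \<open>a\<close>; any two of them differ by an element that centralizes \<open>a\<close>,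
  thus \<open>A\<close> has index two and \<open>G\<close> is generalized quaternion.\<close>

theorem p_group_unique_prime_subgroup:
  assumes p: "prime p" and ordG: "order G = p ^ n" and uniq: "unique_prime_subgroup G p"
  shows "cyclic_group G \<or> generalized_quaternion G"
proof (subst disj_commute, rule disjCI)
  assume nc: "\<not> cyclic_group G"
  have p0: "p > 0" using p prime_gt_0_nat by blast
  have fin: "finite (carrier G)"
    using ordG p0 by (metis order_gt_0_iff_finite zero_less_power)
  define abn where "abn A \<longleftrightarrow> A \<lhd> G \<and> (\<forall>x\<in>A. \<forall>y\<in>A. x \<otimes> y = y \<otimes> x)" for A
  have "abn {\<one>}" using one_is_normal by (simp add: abn_def)
  moreover have "\<forall>A. abn A \<longrightarrow> card A < Suc (order G)"
    using fin by (auto simp: abn_def order_def less_Suc_eq_le intro!: card_mono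
        dest!: normal_imp_subgroup subgroup.subset)
  ultimately obtain A where "abn A" and max: "\<And>B. abn B \<Longrightarrow> card B \<le> card A"
    using ex_has_greatest_nat[of abn "{\<one>}" card "Suc (order G)"] by blast
  then have A: "A \<lhd> G" and abel: "\<And>x y. x \<in> A \<Longrightarrow> y \<in> A \<Longrightarrow> x \<otimes> y = y \<otimes> x"
    by (auto simp: abn_def)
  interpret A: normal A G by fact
  have AG: "A \<subseteq> carrier G" by (rule A.subset)
  have self_cent: "c \<in> A" if "c \<in> carrier G" "\<And>a. a \<in> A \<Longrightarrow> c \<otimes> a = a \<otimes> c" for c
    using maximal_abelian_normal_self_centralizing[OF p ordG A abel _ that] max
    by (simp add: abn_def)
  have ppow: "x [^] (p ^ n :: nat) = \<one>" if "x \<in> carrier G" for x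
    using pow_order_eq_1[OF that] ordG by simp
  have finA: "finite A" using AG fin by (rule finite_subset)
  interpret AA: group "G\<lparr>carrier := A\<rparr>" by (rule subgroup_imp_group) (rule A.subgroup_axioms)
  have "cyclic_group (G\<lparr>carrier := A\<rparr>)"
  proof (rule cyclic_subgroup_of_unique_prime_subgroups[OF A.subgroup_axioms finA abel])
    fix q :: nat assume q: "prime q"
    show "unique_prime_subgroup (G\<lparr>carrier := A\<rparr>) q"
    proof (cases "q = p")
      case True
      then show ?thesis using uniq AG by (auto simp: unique_prime_subgroup_def)
    next
      case False
      have "y = \<one>" if "y \<in> A" "y [^] q = \<one>" for y
      proof -
        have y: "y \<in> carrier G" using that AG by auto
        then have "ord y dvd q" "ord y dvd p ^ n" using that ppow pow_eq_id by blast+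
        moreover have "coprime q (p ^ n)" using False p q by (simp add: primes_coprime)
        ultimately have "ord y = 1" by (metis coprime_common_divisor_nat)
        then show ?thesis using ord_eq_1[OF y] by simp
      qed
      then show ?thesis by (auto simp: unique_prime_subgroup_def)
    qed
  qed
  then obtain a where a: "a \<in> A" and Aa: "\<And>x. x \<in> A \<Longrightarrow> \<exists>i::nat. x = a [^] i"
    using AA.cyclic_group_iff_nat_pow finA by auto
  have aG: "a \<in> carrier G" using a AG by auto
  have powA: "a [^] (i::nat) \<in> A" for i using pow_subgroup_closed[OF A.subgroup_axioms a] .
  have A_gen: "A = generate G {a}"
    using generate_pow_on_finite_carrier[OF fin aG] Aa powA by auto
  have "ord a dvd p ^ n" using ppow[OF aG] pow_eq_id[OF aG] by blast
  then obtain m where m: "ord a = p ^ m" using p divides_primepow_nat by blast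
  have cardA: "card A = p ^ m" using A_gen m generate_pow_card[OF aG] by simp
  have cent: "c \<in> A" if c: "c \<in> carrier G" "c \<otimes> a = a \<otimes> c" for c
  proof (rule self_cent[OF c(1)])
    fix b assume "b \<in> A"
    then obtain i :: nat where "b = a [^] i" using Aa by blast
    then show "c \<otimes> b = b \<otimes> c"
      using group_commutes_pow[of a c i] c aG by simp
  qed
  have skew: "\<exists>u::nat. w \<otimes> a = a [^] u \<otimes> w" if w: "w \<in> carrier G" for w
  proof -
    obtain u :: nat where "w \<otimes> a \<otimes> inv w = a [^] u" using A.inv_op_closed2[OF w a] Aa by blast
    then have "w \<otimes> a \<otimes> inv w \<otimes> w = a [^] u \<otimes> w" by simp
    then show ?thesis using w aG by (auto simp: m_assoc)
  qed
  \<comment> \<open>Commuting with \<open>a\<close> is excluded by self-centralization, and an element with trivial \<open>p\<close>-th power in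
      the coset of \<open>w\<close> by the uniqueness of the subgroup of order \<open>p\<close>.\<close>
  have inverts: "p = 2 \<and> w \<otimes> a = inv a \<otimes> w \<and> (\<exists>r. m = Suc r \<and> w [^] (2::nat) = a [^] (2 ^ r :: nat))"
    if w: "w \<in> carrier G" "w \<notin> A" "w [^] p \<in> A" for w
  proof -
    have m0: "m \<noteq> 0"
    proof
      assume "m = 0"
      then have "a = \<one>" using m ord_eq_1[OF aG] by simp
      then show False using cent[OF w(1)] w by simp
    qed
    \<comment> \<open>A generator of the subgroup of order \<open>p\<close>: an element of order \<open>p\<close> is a power of \<open>z\<close>, so it lies in \<open>A\<close>.\<close>
    define z where "z = a [^] (p ^ (m - 1))"
    have "z [^] p = a [^] (p ^ m)" unfolding z_def using aG m0
      by (simp add: nat_pow_pow power_eq_if mult.commute)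
    then have zp: "z [^] p = \<one>" using pow_eq_id[OF aG] m by simp
    have "z \<noteq> \<one>" unfolding z_def using pow_eq_id[OF aG] m m0 p
      by (metis diff_less le_zero_eq less_numeral_extra(1) neq0_conv not_less power_dvd_imp_le prime_gt_1_nat)
    have no: "(a [^] (i::nat) \<otimes> w) [^] p \<noteq> \<one>" for i
    proof
      assume 1: "(a [^] i \<otimes> w) [^] p = \<one>"
      have "a [^] i \<otimes> w \<in> carrier G" "z \<in> carrier G" using aG w z_def by auto
      then obtain k :: nat where "a [^] i \<otimes> w = z [^] k"
        using uniq 1 zp \<open>z \<noteq> \<one>\<close> unfolding unique_prime_subgroup_def by blast
      then have "a [^] i \<otimes> w \<in> A" using aG powA by (simp add: z_def nat_pow_pow)
      then have "inv (a [^] i) \<otimes> (a [^] i \<otimes> w) \<in> A" using powA by blast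
      then show False using w aG by (simp add: m_assoc[symmetric])
    qed
    obtain u :: nat where u: "w \<otimes> a = a [^] u \<otimes> w" using skew[OF w(1)] by blast
    obtain s :: nat where s: "w [^] p = a [^] s" using Aa[OF w(3)] by blast
    show ?thesis
      using commutes_or_inverts[OF p aG w(1) m u s no] cent[OF w(1)] w(2) by blast
  qed
  have outside: "p = 2 \<and> x \<otimes> a = inv a \<otimes> x \<and> (\<exists>r. m = Suc r \<and> x [^] (2::nat) = a [^] (2 ^ r :: nat))"
    if x: "x \<in> carrier G" "x \<notin> A" for x
  proof -
    have "\<exists>k. x [^] (p ^ k) \<in> A" using ppow[OF x(1)] A.one_closed by metis
    define k where "k = (LEAST k. x [^] (p ^ k) \<in> A)"
    have k: "x [^] (p ^ k) \<in> A" unfolding k_def using \<open>\<exists>k. _\<close> by (rule LeastI_ex)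
    have "k \<noteq> 0" using k x by (metis nat_pow_eone power_0)
    then obtain j where j: "k = Suc j" by (cases k) auto
    define w where "w = x [^] (p ^ j)"
    have wA: "w \<notin> A" unfolding w_def using not_less_Least[of j "\<lambda>k. x [^] (p ^ k) \<in> A"] j k_def by simp
    have wG: "w \<in> carrier G" using x w_def by simp
    have "w [^] p \<in> A" unfolding w_def using k j x by (simp add: nat_pow_pow mult.commute)
    note inv_w = inverts[OF wG wA this]
    show ?thesis
    proof (cases j)
      case 0
      then show ?thesis using inv_w x by (simp add: w_def)
    next
      case (Suc i)
      \<comment> \<open>Here \<open>w\<close> is the square of some \<open>v\<close>; but \<open>-1\<close> is not a square modulo \<open>4\<close>.\<close>
      define v where "v = x [^] (2 ^ i :: nat)"
      have v: "v \<in> carrier G" using x v_def by simp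
      have wv: "w = v \<otimes> v" unfolding w_def v_def using Suc inv_w x by (simp add: nat_pow_mult mult_2)
      obtain t :: nat where t: "v \<otimes> a = a [^] t \<otimes> v" using skew[OF v] by blast
      have "inv a \<otimes> w = v \<otimes> (v \<otimes> a)" using inv_w wv v aG by (simp add: m_assoc)
      also have "\<dots> = (v \<otimes> a [^] t) \<otimes> v" using t v aG by (simp add: m_assoc)
      also have "\<dots> = a [^] (t * t) \<otimes> w"
        using skew_commute_pow[OF aG v t, of t] wv v aG by (simp add: m_assoc)
      finally have "inv a = a [^] (t * t)" using wG aG by simp
      then have "a [^] Suc (t * t) = \<one>" using aG by (metis l_inv nat_pow_Suc)
      then have dvd: "2 ^ m dvd Suc (t * t)" using pow_eq_id[OF aG] m inv_w by metis
      have "\<not> 4 dvd Suc (t * t)"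
      proof -
        have "t mod 4 = 0 \<or> t mod 4 = 1 \<or> t mod 4 = 2 \<or> t mod 4 = 3" by presburger
        then have "(t mod 4 * (t mod 4) + 1) mod 4 \<noteq> 0" by auto
        then have "(t * t + 1) mod 4 \<noteq> 0" by (metis mod_add_left_eq mod_mult_eq)
        then show ?thesis by (simp add: dvd_eq_mod_eq_0)
      qed
      then have "m < 2" using dvd le_imp_power_dvd[of 2 m "2::nat"]
        by (metis dvd_trans not_less num_double numeral_times_numeral power2_eq_square)
      then have "m = 1" using inv_w by auto
      then have "a \<otimes> a = \<one>" using m inv_w pow_eq_id[OF aG, of 2] aG by (simp add: numeral_2_eq_2)
      then have "inv a = a" using aG inv_equality by blast
      then have "w \<in> A" using inv_w cent[OF wG] by simp
      then show ?thesis using wA by simp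
    qed
  qed
  have "A \<noteq> carrier G"
    using nc \<open>cyclic_group (G\<lparr>carrier := A\<rparr>)\<close> by auto
  then obtain y where y: "y \<in> carrier G" "y \<notin> A" using AG by blast
  \<comment> \<open>From here on \<open>p = 2\<close>, and \<open>a\<close> and \<open>y\<close> satisfy the quaternion relations.\<close>
  obtain r where r: "m = Suc r" "y [^] (2::nat) = a [^] (2 ^ r :: nat)" and p2: "p = 2"
    and ya: "y \<otimes> a = inv a \<otimes> y" using outside[OF y] by blast
  have ayi: "inv y \<otimes> a \<otimes> y = inv a"
  proof -
    have "a \<otimes> y = y \<otimes> inv a"
      using ya y aG by (metis inv_closed inv_solve_left inv_solve_right m_assoc m_closed inv_inv)
    then have "inv y \<otimes> a \<otimes> y = inv y \<otimes> (y \<otimes> inv a)" using y aG by (simp add: m_assoc)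
    also have "\<dots> = inv a" using y aG by (simp add: m_assoc[symmetric])
    finally show ?thesis .
  qed
  have coset: "inv y \<otimes> x \<in> A" if x: "x \<in> carrier G" "x \<notin> A" for x
  proof (rule cent)
    have xa: "x \<otimes> a = inv a \<otimes> x" using outside[OF x] by blast
    have "inv y \<otimes> x \<otimes> a = inv y \<otimes> inv a \<otimes> x" using xa x y aG by (simp add: m_assoc)
    also have "inv y \<otimes> inv a = a \<otimes> inv y"
    proof -
      have "a \<otimes> inv y = inv y \<otimes> (y \<otimes> a) \<otimes> inv y" using y aG by (simp add: m_assoc[symmetric])
      also have "\<dots> = inv y \<otimes> inv a" using ya y aG by (simp add: m_assoc)
      finally show ?thesis by simp
    qed
    finally show "inv y \<otimes> x \<otimes> a = a \<otimes> (inv y \<otimes> x)" using x y aG by (simp add: m_assoc)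
  qed (use x y in simp)
  have split: "carrier G = A \<union> (\<lambda>b. y \<otimes> b) ` A"
  proof
    show "carrier G \<subseteq> A \<union> (\<lambda>b. y \<otimes> b) ` A"
    proof
      fix x assume x: "x \<in> carrier G"
      show "x \<in> A \<union> (\<lambda>b. y \<otimes> b) ` A"
      proof (cases "x \<in> A")
        case False
        have "x = y \<otimes> (inv y \<otimes> x)" using x y by (simp add: m_assoc[symmetric])
        then show ?thesis using coset[OF x False] by blast
      qed simp
    qed
  qed (use AG y in auto)
  have "order G \<le> card A + card A"
    unfolding order_def split using finA card_Un_le card_image_le
    by (meson add_left_mono le_trans)
  also have "\<dots> = 2 ^ Suc m" using cardA p2 by simp
  finally have "(2::nat) ^ n \<le> 2 ^ Suc m" using ordG p2 by simp
  then have "n \<le> Suc m" by (rule power_le_imp_le_exp[rotated]) simp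
  moreover have "card A < order G"
    unfolding order_def using AG y fin by (intro psubset_card_mono) auto
  then have "m < n" using ordG p2 cardA by simp
  ultimately have n: "n = Suc m" by simp
  have gen: "generate G {a, y} = carrier G"
  proof
    have sub: "{a, y} \<subseteq> carrier G" using aG y by auto
    show "generate G {a, y} \<subseteq> carrier G" by (rule generate_incl[OF sub])
    have sg: "subgroup (generate G {a, y}) G" by (rule generate_is_subgroup[OF sub])
    have "a \<in> generate G {a, y}" "y \<in> generate G {a, y}" by (auto intro: generate.incl)
    moreover from this have "A \<subseteq> generate G {a, y}"
      using Aa pow_subgroup_closed[OF sg] by blast
    ultimately show "carrier G \<subseteq> generate G {a, y}"
      unfolding split using subgroup.m_closed[OF sg] by blast
  qed
  \<comment> \<open>If \<open>a\<close> had order two, inverting it would mean commuting with it.\<close>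
  have "m \<noteq> 1"
  proof
    assume "m = 1"
    then have "a \<otimes> a = \<one>" using m p2 pow_eq_id[OF aG, of 2] aG by (simp add: numeral_2_eq_2)
    then have "inv a = a" using aG inv_equality by blast
    then show False using ya cent[OF y(1)] y by simp
  qed
  then have "n \<ge> 3" using n r by simp
  moreover have "a [^] (2 ^ (n - 1) :: nat) = \<one>" using pow_eq_id[OF aG] m p2 n by simp
  moreover have "y [^] (2::nat) = a [^] (2 ^ (n - 2) :: nat)" using r n by simp
  ultimately show "generalized_quaternion G"
    unfolding generalized_quaternion_def
    using is_group ordG p2 aG y gen ayi by blast
qed

end

context group
begin

lemma unique_prime_subgroupI:
  fixes p :: nat
  assumes "prime p" "z \<in> carrier G"
    and "\<And>x. x \<in> carrier G \<Longrightarrow> x [^] p = \<one> \<Longrightarrow> \<exists>i::nat. x = z [^] i"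
  shows "unique_prime_subgroup G p"
  unfolding unique_prime_subgroup_def using power_of_prime_order_element[OF assms(1,2)] assms(3) by metis

lemma cyclic_unique_prime_subgroup:
  assumes "finite (carrier G)" "cyclic_group G" "prime p"
  shows "unique_prime_subgroup G p"
  using assms cyclic_group_iff_nat_pow unique_prime_subgroupI by metis

text \<open>The relations show that \<open>G\<close> is the union of \<open>\<langle>x\<rangle>\<close> and \<open>\<langle>x\<rangle>y\<close>, and comparison with the order
  of \<open>G\<close> gives \<open>x\<close> the full order \<open>2 ^ (n - 1)\<close>. Every element of \<open>\<langle>x\<rangle>y\<close> has the square \<open>y [^] 2\<close>, which is
  not trivial, so all involutions lie in the cyclic group \<open>\<langle>x\<rangle>\<close>.\<close>

lemma generalized_quaternion_unique_prime_subgroup: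
  assumes gq: "generalized_quaternion G"
  shows "unique_prime_subgroup G 2"
proof -
  obtain n x y where n: "n \<ge> 3" "order G = 2 ^ n" and x: "x \<in> carrier G" and y: "y \<in> carrier G"
    and gen: "generate G {x, y} = carrier G" and xn: "x [^] (2 ^ (n - 1) :: nat) = \<one>"
    and y2: "y [^] (2::nat) = x [^] (2 ^ (n - 2) :: nat)" and rel: "inv y \<otimes> x \<otimes> y = inv x"
    using gq unfolding generalized_quaternion_def by blast
  have fin: "finite (carrier G)" using n order_gt_0_iff_finite by simp
  define u where "u = ord x - 1"
  have u1: "1 + u = ord x" using ord_ge_1[OF fin x] by (simp add: u_def)
  have invx: "inv x = x [^] u" unfolding u_def by (rule inv_eq_pow[OF fin x])
  have skew: "y \<otimes> x = x [^] u \<otimes> y"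
  proof -
    have "x \<otimes> y = y \<otimes> (inv y \<otimes> x \<otimes> y)" using x y by (simp add: m_assoc[symmetric])
    then have "x \<otimes> y = y \<otimes> inv x" using rel by simp
    then have "inv x \<otimes> (x \<otimes> y) \<otimes> x = inv x \<otimes> (y \<otimes> inv x) \<otimes> x" by simp
    moreover have "inv x \<otimes> (x \<otimes> y) \<otimes> x = y \<otimes> x" using x y by (simp add: m_assoc[symmetric])
    moreover have "inv x \<otimes> (y \<otimes> inv x) \<otimes> x = inv x \<otimes> y" using x y by (simp add: m_assoc)
    ultimately show ?thesis using invx by simp
  qed
  have yx: "y \<otimes> x [^] (k::nat) = x [^] (u * k) \<otimes> y" for k
    by (rule skew_commute_pow[OF x y skew])
  define K where "K = range (\<lambda>i::nat. x [^] i)"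
  define T where "T = K \<union> (\<lambda>k. k \<otimes> y) ` K"
  have KG: "K \<subseteq> carrier G" using x by (auto simp: K_def)
  have KK: "a \<otimes> b \<in> K" if "a \<in> K" "b \<in> K" for a b
    using that x by (auto simp: K_def nat_pow_mult)
  have yK: "\<exists>b'\<in>K. y \<otimes> b = b' \<otimes> y" if "b \<in> K" for b
    using that yx by (auto simp: K_def)
  have yy: "y \<otimes> y \<in> K" using y2 y by (auto simp: K_def numeral_2_eq_2)
  have "subgroup T G"
  proof (rule finite_submonoid_subgroup[OF fin])
    show "T \<subseteq> carrier G" using KG y by (auto simp: T_def)
    show "\<one> \<in> T" unfolding T_def K_def by (auto intro: range_eqI[of _ _ 0])
    fix s t assume s: "s \<in> T" and t: "t \<in> T"
    have yt: "y \<otimes> t \<in> T"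
    proof (cases "t \<in> K")
      case True then show ?thesis using yK unfolding T_def by blast
    next
      case False
      then obtain b where b: "b \<in> K" "t = b \<otimes> y" using t by (auto simp: T_def)
      obtain b' where b': "b' \<in> K" "y \<otimes> b = b' \<otimes> y" using yK b by blast
      have "y \<otimes> t = b' \<otimes> (y \<otimes> y)"
        using b b' KG y by (metis m_assoc subsetD)
      then show ?thesis using KK[OF b'(1) yy] by (simp add: T_def)
    qed
    have Kt: "a \<otimes> t \<in> T" if "a \<in> K" "t \<in> T" for a t
      using that KK KG y unfolding T_def by (auto simp: m_assoc[symmetric] subset_iff)
    show "s \<otimes> t \<in> T"
    proof (cases "s \<in> K")
      case True then show ?thesis using Kt t by blast
    next
      case False
      then obtain a where a: "a \<in> K" "s = a \<otimes> y" using s by (auto simp: T_def)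
      have "t \<in> carrier G" using t KG y by (auto simp: T_def)
      then have "s \<otimes> t = a \<otimes> (y \<otimes> t)" using a KG y by (auto simp: m_assoc)
      then show ?thesis using Kt[OF a(1) yt] by simp
    qed
  qed
  moreover have "x \<in> K" unfolding K_def using x by (auto intro: range_eqI[of _ _ 1])
  moreover have "\<one> \<in> K" unfolding K_def by (auto intro: range_eqI[of _ _ 0])
  then have "\<one> \<otimes> y \<in> T" unfolding T_def by blast
  ultimately have "{x, y} \<subseteq> T" using y by (simp add: T_def)
  then have "carrier G \<subseteq> T"
    using generate_subgroup_incl[OF _ \<open>subgroup T G\<close>] gen by metis
  \<comment> \<open>If \<open>x\<close> had a smaller order than \<open>2 ^ (n - 1)\<close>, then \<open>T\<close> would be too small to be all of \<open>G\<close>.\<close>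
  have "K = generate G {x}"
    using generate_pow_on_finite_carrier[OF fin x] by (auto simp: K_def)
  then have cardK: "card K = ord x" using generate_pow_card[OF x] by simp
  have finK: "finite K" using KG fin finite_subset by blast
  have "order G \<le> card T" unfolding order_def
    using \<open>carrier G \<subseteq> T\<close> finK by (intro card_mono) (auto simp: T_def)
  also have "\<dots> \<le> card K + card K"
    unfolding T_def using finK card_Un_le card_image_le by (meson add_left_mono le_trans)
  finally have le: "2 ^ n \<le> 2 * ord x" using n cardK by simp
  have ox: "\<not> ord x dvd 2 ^ (n - 2)"
  proof
    assume "ord x dvd 2 ^ (n - 2)"
    then have "ord x \<le> 2 ^ (n - 2)" by (simp add: dvd_imp_le)
    then have "2 ^ n \<le> 2 * (2 ^ (n - 2) :: nat)" using le by simp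
    moreover obtain k where "n = k + 2" using n by (intro that[of "n - 2"]) simp
    ultimately show False by simp
  qed
  have "t \<in> K" if t: "t \<in> carrier G" "t [^] (2::nat) = \<one>" for t
  proof (rule ccontr)
    assume "t \<notin> K"
    then obtain i :: nat where i: "t = x [^] i \<otimes> y"
      using t \<open>carrier G \<subseteq> T\<close> by (auto simp: T_def K_def)
    have "t [^] (2::nat) = x [^] (i * (\<Sum>j<2. u ^ j)) \<otimes> y [^] (2::nat)"
      unfolding i by (rule skew_mult_pow[OF x y skew])
    also have "i * (\<Sum>j<2. u ^ j) = ord x * i" using u1 by (simp add: numeral_2_eq_2)
    also have "x [^] (ord x * i) = \<one>" using pow_eq_id[OF x] by simp
    finally have "t [^] (2::nat) = x [^] (2 ^ (n - 2) :: nat)" using y2 x by simp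
    then show False using t(2) pow_eq_id[OF x] ox by metis
  qed
  then show ?thesis
    using x by (intro unique_prime_subgroupI[of 2 x]) (auto simp: K_def)
qed

text \<open>Every element of order \<open>p\<close> has a conjugate in \<open>P\<close>, which is a power of \<open>z\<close>; since \<open>z\<close> is
  central, the conjugation does nothing.\<close>

lemma unique_prime_subgroup_of_sylow:
  assumes fin: "finite (carrier G)" and syl: "sylow_subgroup G p P"
    and uniq: "unique_prime_subgroup (G\<lparr>carrier := P\<rparr>) p"
    and z: "z \<in> P" "z \<in> group_center G" "z [^] p = \<one>" "z \<noteq> \<one>"
  shows "unique_prime_subgroup G p"
proof (rule unique_prime_subgroupI[of p z])
  show p: "prime p" using syl by (simp add: sylow_subgroup_def)
  show zG: "z \<in> carrier G" using z by (simp add: group_center_def)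
  fix x assume x: "x \<in> carrier G" "x [^] p = \<one>"
  then obtain h where h: "h \<in> carrier G" "h \<otimes> x \<otimes> inv h \<in> P"
    using conjugate_into_sylow_subgroup[OF fin syl x(1), of 1] by auto
  have "(h \<otimes> x \<otimes> inv h) [^] p = h \<otimes> x [^] p \<otimes> inv h"
    using conj_pow[OF h(1) x(1)] by simp
  then have "(h \<otimes> x \<otimes> inv h) [^] p = \<one>" using x h by simp
  then obtain k :: nat where k: "h \<otimes> x \<otimes> inv h = z [^] k"
    using uniq h z unfolding unique_prime_subgroup_def by auto
  have "h \<otimes> z [^] k = z [^] k \<otimes> h"
    using group_commutes_pow[of z h k] z h zG by (auto simp: group_center_def)
  moreover have "h \<otimes> x = z [^] k \<otimes> h"
    using k h x by (metis inv_solve_right m_closed inv_closed nat_pow_closed zG)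
  ultimately have "h \<otimes> x = h \<otimes> z [^] k" by simp
  then have "x = z [^] k" using h x zG by simp
  then show "\<exists>i::nat. x = z [^] i" by blast
qed

section \<open>Primary parts of an element\<close>

lemma central_pow:
  assumes "z \<in> group_center G"
  shows "z [^] (k::nat) \<in> group_center G"
  using assms group_commutes_pow[of z] by (auto simp: group_center_def)

text \<open>The three claims depend on each other in the induction: moving a factor past the product of the
  others requires that product to commute with it.\<close>

lemma finprod_commuting:
  assumes "finite A" and "\<And>i. i \<in> A \<Longrightarrow> f i \<in> carrier G"
    and "\<And>i j. i \<in> A \<Longrightarrow> j \<in> A \<Longrightarrow> f i \<otimes> f j = f j \<otimes> f i"
  shows finprod_commuting_closed: "finprod G f A \<in> carrier G"
    and finprod_commutes: "\<And>c. c \<in> carrier G \<Longrightarrow> (\<And>i. i \<in> A \<Longrightarrow> c \<otimes> f i = f i \<otimes> c) \<Longrightarrow>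
      c \<otimes> finprod G f A = finprod G f A \<otimes> c"
    and finprod_commuting_pow_eq_one: "\<And>m::nat. (\<And>i. i \<in> A \<Longrightarrow> f i [^] m = \<one>) \<Longrightarrow>
      finprod G f A [^] m = \<one>"
proof -
  have "finprod G f A \<in> carrier G \<and>
    (\<forall>c\<in>carrier G. (\<forall>i\<in>A. c \<otimes> f i = f i \<otimes> c) \<longrightarrow> c \<otimes> finprod G f A = finprod G f A \<otimes> c) \<and>
    (\<forall>m::nat. (\<forall>i\<in>A. f i [^] m = \<one>) \<longrightarrow> finprod G f A [^] m = \<one>)"
    using assms
  proof (induction A)
    case empty
    then show ?case by (simp add: finprod_commuting_empty)
  next
    case (insert a A)
    let ?h = "finprod G f A"
    have IH: "?h \<in> carrier G"
      "\<And>c. c \<in> carrier G \<Longrightarrow> \<forall>i\<in>A. c \<otimes> f i = f i \<otimes> c \<Longrightarrow> c \<otimes> ?h = ?h \<otimes> c"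
      "\<And>m::nat. \<forall>i\<in>A. f i [^] m = \<one> \<Longrightarrow> ?h [^] m = \<one>"
      using insert.IH insert.prems by simp_all
    have a: "f a \<in> carrier G" using insert.prems by simp
    have eq: "finprod G f (insert a A) = f a \<otimes> ?h"
      using insert.hyps insert.prems by (intro finprod_commuting_insert)
    have comm: "f a \<otimes> ?h = ?h \<otimes> f a" using IH(2)[OF a] insert.prems by simp
    show ?case
      unfolding eq
    proof (intro conjI ballI impI allI)
      show "f a \<otimes> ?h \<in> carrier G" using a IH by simp
      fix c assume c: "c \<in> carrier G" "\<forall>i\<in>insert a A. c \<otimes> f i = f i \<otimes> c"
      have "c \<otimes> (f a \<otimes> ?h) = f a \<otimes> (c \<otimes> ?h)"
        using c a IH(1) by (simp add: m_assoc[symmetric])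
      also have "c \<otimes> ?h = ?h \<otimes> c" using IH(2) c by simp
      finally show "c \<otimes> (f a \<otimes> ?h) = f a \<otimes> ?h \<otimes> c" using c a IH(1) by (simp add: m_assoc)
    next
      fix m :: nat assume m: "\<forall>i\<in>insert a A. f i [^] m = \<one>"
      then show "(f a \<otimes> ?h) [^] m = \<one>"
        using pow_mult_distrib[OF comm a IH(1), of m] IH(3)[of m] by simp
    qed
  qed
  then show "finprod G f A \<in> carrier G"
    and "\<And>c. c \<in> carrier G \<Longrightarrow> (\<And>i. i \<in> A \<Longrightarrow> c \<otimes> f i = f i \<otimes> c) \<Longrightarrow>
      c \<otimes> finprod G f A = finprod G f A \<otimes> c"
    and "\<And>m::nat. (\<And>i. i \<in> A \<Longrightarrow> f i [^] m = \<one>) \<Longrightarrow> finprod G f A [^] m = \<one>"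
    by blast+
qed

text \<open>Let \<open>m\<close> be the product of the orders of the other parts. Raising \<open>g\<close> to the power \<open>m\<close> removes
  them, and since \<open>m\<close> is prime to \<open>p\<close>, the part \<open>gp p\<close> can be recovered from \<open>gp p [^] m = g [^] m\<close>.
  If this part were trivial, the order of \<open>g\<close> would divide \<open>m\<close>.\<close>

lemma primary_part_is_power:
  assumes fin: "finite \<pi>" and pr: "\<And>q. q \<in> \<pi> \<Longrightarrow> prime q"
    and gp: "\<And>q. q \<in> \<pi> \<Longrightarrow> p_element G q (gp q)"
    and comm: "\<And>q r. q \<in> \<pi> \<Longrightarrow> r \<in> \<pi> \<Longrightarrow> gp q \<otimes> gp r = gp r \<otimes> gp q"
    and g: "g = finprod G gp \<pi>" and p: "p \<in> \<pi>" "p dvd ord g"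
  shows "\<exists>k::nat. gp p = g [^] k" and "gp p \<noteq> \<one>"
proof -
  let ?A = "\<pi> - {p}"
  define h where "h = finprod G gp ?A"
  define m where "m = (\<Prod>q\<in>?A. ord (gp q))"
  have closed: "\<And>q. q \<in> \<pi> \<Longrightarrow> gp q \<in> carrier G" using gp by (simp add: p_element_def)
  have A: "finite ?A" "\<And>q. q \<in> ?A \<Longrightarrow> gp q \<in> carrier G"
    "\<And>q r. q \<in> ?A \<Longrightarrow> r \<in> ?A \<Longrightarrow> gp q \<otimes> gp r = gp r \<otimes> gp q"
    using fin closed comm by auto
  have gph: "gp p \<in> carrier G" "h \<in> carrier G"
    using closed p finprod_commuting_closed[OF A] by (auto simp: h_def)
  have "g = finprod G gp (insert p ?A)" using g p by (simp add: insert_absorb)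
  also have "\<dots> = gp p \<otimes> h"
    unfolding h_def using fin closed comm p by (intro finprod_commuting_insert) auto
  finally have gh: "g = gp p \<otimes> h" .
  have c: "gp p \<otimes> h = h \<otimes> gp p"
    unfolding h_def using closed comm p by (intro finprod_commutes[OF A]) auto
  have "gp q [^] m = \<one>" if q: "q \<in> ?A" for q
  proof -
    have "ord (gp q) dvd m" unfolding m_def using A(1) q by (rule dvd_prodI)
    then show ?thesis using pow_eq_id[OF A(2)[OF q]] by blast
  qed
  then have "h [^] m = \<one>" unfolding h_def by (intro finprod_commuting_pow_eq_one[OF A])
  then have gm: "g [^] m = gp p [^] m"
    using pow_mult_distrib[OF c gph, of m] gph by (simp add: gh)
  have cop: "coprime m p" unfolding m_def
  proof (rule prod_coprime_left)
    fix q assume q: "q \<in> ?A"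
    then obtain e where "ord (gp q) = q ^ e" using gp by (auto simp: p_element_def)
    then show "coprime (ord (gp q)) p" using q p pr by (simp add: primes_coprime)
  qed
  obtain e where e: "ord (gp p) = p ^ e" using gp p by (auto simp: p_element_def)
  have "gp p [^] (p ^ e) = \<one>" using pow_eq_id[OF gph(1)] e by simp
  moreover have "coprime m (p ^ e)" using cop by simp
  ultimately obtain k :: nat where "(gp p [^] m) [^] k = gp p"
    using recover_from_coprime_pow[OF gph(1)] by blast
  moreover have gG: "g \<in> carrier G" using gh gph by simp
  ultimately show "\<exists>k::nat. gp p = g [^] k" using gm by (metis nat_pow_pow)
  show "gp p \<noteq> \<one>"
  proof
    assume "gp p = \<one>"
    then have "ord g dvd m" using gm pow_eq_id[OF gG] by simp
    then have "p dvd m" using p dvd_trans by blast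
    then have "is_unit p" using cop by (meson coprime_common_divisor dvd_refl)
    then show False using pr[OF p(1)] by simp
  qed
qed

lemma prime_order_power:
  assumes x: "x \<in> carrier G" and p: "prime p" and e: "ord x = p ^ e" and nt: "x \<noteq> \<one>"
  obtains k :: nat where "x [^] k \<noteq> \<one>" "(x [^] k) [^] p = \<one>"
proof -
  have "e \<noteq> 0" using e nt ord_eq_1[OF x] by auto
  then obtain d where d: "e = Suc d" by (cases e) auto
  have "\<not> p ^ e dvd p ^ d"
    using prime_gt_1_nat[OF p] d by (simp add: dvd_power_iff_le)
  then have "x [^] (p ^ d) \<noteq> \<one>" using pow_eq_id[OF x] e by simp
  moreover have "(x [^] (p ^ d)) [^] p = \<one>"
    using x e d pow_eq_id[OF x] by (simp add: nat_pow_pow mult.commute)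
  ultimately show ?thesis using that by blast
qed

section \<open>Dominating vertices of the cyclic graph\<close>

text \<open>Adjacency says nothing about \<open>x = g\<close> and \<open>x = \<one>\<close>, but there \<open>c = g\<close> serves.\<close>

lemma dominating_vertexD:
  assumes fin: "finite (carrier G)" and dom: "dominating_vertex (cyclic_graph G) g"
    and x: "x \<in> carrier G"
  obtains c and i j :: nat where "c \<in> carrier G" "g = c [^] i" "x = c [^] j"
proof -
  have g: "g \<in> carrier G" using dom by (simp add: dominating_vertex_def cyclic_graph_def)
  show ?thesis
  proof (cases "x = \<one> \<or> x = g")
    case True
    have "g = g [^] (1::nat)" "\<one> = g [^] (0::nat)" using g by auto
    then show ?thesis using that g True by metis
  next
    case False
    then have "cyclic_group (subgroup_generated G {g, x})"
      using dom x by (auto simp: dominating_vertex_def cyclic_graph_def)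
    moreover have S: "subgroup (generate G {g, x}) G"
      using g x by (intro generate_is_subgroup) auto
    moreover have "subgroup_generated G {g, x} = G\<lparr>carrier := generate G {g, x}\<rparr>"
      using g x by (simp add: subgroup_generated_def Int_absorb1)
    moreover have "finite (generate G {g, x})"
      using subgroup.subset[OF S] fin finite_subset by blast
    ultimately obtain c where c: "c \<in> generate G {g, x}"
      and all: "\<forall>y\<in>generate G {g, x}. \<exists>n::nat. y = c [^] n"
      using group.cyclic_group_iff_nat_pow[OF subgroup_imp_group[OF S]] by auto
    have "g \<in> generate G {g, x}" "x \<in> generate G {g, x}" by (auto intro: generate.incl)
    then obtain i j :: nat where "g = c [^] i" "x = c [^] j" using all by metis
    then show ?thesis using that c subgroup.subset[OF S] by blast
  qed
qed

text \<open>The generated group consists of the products \<open>g [^] i \<otimes> x [^] j\<close>, so it is abelian, and it suffices to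
  count subgroups of prime order \<open>q\<close>. If \<open>q\<close> divides the order of \<open>g\<close>, there is at most one in all of \<open>G\<close>.
  Otherwise an element of order \<open>q\<close> is a power of its own \<open>ord g\<close>-th power, from which the factor \<open>g [^] i\<close> has
  disappeared; so it is a power of \<open>x\<close>.\<close>

lemma cyclic_generated_with_central:
  assumes fin: "finite (carrier G)" and g: "g \<in> group_center G" and x: "x \<in> carrier G"
    and uniq: "\<And>q. prime q \<Longrightarrow> q dvd ord g \<Longrightarrow> unique_prime_subgroup G q"
  shows "cyclic_group (subgroup_generated G {g, x})"
proof -
  have gG: "g \<in> carrier G" using g by (simp add: group_center_def)
  define H where "H = {g [^] (i::nat) \<otimes> x [^] (j::nat) | i j. True}"
  have comm: "x [^] (j::nat) \<otimes> g [^] (i::nat) = g [^] i \<otimes> x [^] j" for i j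
    using central_pow[OF g, of i] x by (simp add: group_center_def)
  have mult: "(g [^] (i::nat) \<otimes> x [^] (j::nat)) \<otimes> (g [^] (k::nat) \<otimes> x [^] (l::nat)) =
      g [^] (i + k) \<otimes> x [^] (j + l)" for i j k l
  proof -
    have "(g [^] i \<otimes> x [^] j) \<otimes> (g [^] k \<otimes> x [^] l) = g [^] i \<otimes> (x [^] j \<otimes> g [^] k) \<otimes> x [^] l"
      using gG x by (simp add: m_assoc)
    also have "\<dots> = (g [^] i \<otimes> g [^] k) \<otimes> (x [^] j \<otimes> x [^] l)"
      unfolding comm using gG x by (simp add: m_assoc)
    finally show ?thesis using gG x by (simp add: nat_pow_mult)
  qed
  have HG: "H \<subseteq> carrier G" using gG x by (auto simp: H_def)
  have H: "subgroup H G"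
  proof (rule finite_submonoid_subgroup[OF fin HG])
    have "\<one> = g [^] (0::nat) \<otimes> x [^] (0::nat)" by simp
    then show "\<one> \<in> H" unfolding H_def by blast
    show "\<And>a b. a \<in> H \<Longrightarrow> b \<in> H \<Longrightarrow> a \<otimes> b \<in> H" unfolding H_def using mult by blast
  qed
  have "g = g [^] (1::nat) \<otimes> x [^] (0::nat)" "x = g [^] (0::nat) \<otimes> x [^] (1::nat)"
    using gG x by simp_all
  then have gx: "{g, x} \<subseteq> H" unfolding H_def by blast
  have "H = generate G {g, x}"
  proof (rule generateI[OF H gx])
    fix K assume K: "subgroup K G" "{g, x} \<subseteq> K"
    then show "H \<subseteq> K"
      using pow_subgroup_closed[OF K(1)] subgroup.m_closed[OF K(1)] by (auto simp: H_def)
  qed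
  then have "subgroup_generated G {g, x} = G\<lparr>carrier := H\<rparr>"
    using gG x by (simp add: subgroup_generated_def Int_absorb1)
  moreover have "cyclic_group (G\<lparr>carrier := H\<rparr>)"
  proof (rule cyclic_subgroup_of_unique_prime_subgroups[OF H])
    show "finite H" using HG fin finite_subset by blast
    show "a \<otimes> b = b \<otimes> a" if "a \<in> H" "b \<in> H" for a b
      using that unfolding H_def by (auto simp: mult add.commute)
    fix q :: nat assume q: "prime q"
    show "unique_prime_subgroup (G\<lparr>carrier := H\<rparr>) q"
    proof (cases "q dvd ord g")
      case True
      then show ?thesis
        using uniq[OF q] HG by (auto simp: unique_prime_subgroup_def subset_iff)
    next
      case False
      then have cop: "coprime (ord g) q" using q by (metis coprime_commute prime_imp_coprime)
      have powers: "\<exists>k::nat. a = x [^] k" if a: "a \<in> H" "a [^] q = \<one>" for a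
      proof -
        obtain i j where ij: "a = g [^] (i::nat) \<otimes> x [^] (j::nat)" using a by (auto simp: H_def)
        have "a [^] ord g = (g [^] i) [^] ord g \<otimes> (x [^] j) [^] ord g"
          unfolding ij using gG x by (intro pow_mult_distrib) (simp_all add: comm)
        also have "(g [^] i) [^] ord g = \<one>"
          using gG pow_eq_id[OF gG] by (simp add: nat_pow_pow)
        finally have "a [^] ord g = x [^] (j * ord g)" using x by (simp add: nat_pow_pow)
        moreover obtain k :: nat where "(a [^] ord g) [^] k = a"
          using recover_from_coprime_pow[of a q "ord g"] a HG cop by blast
        ultimately show ?thesis using x by (metis nat_pow_pow)
      qed
      interpret H: group "G\<lparr>carrier := H\<rparr>" by (rule subgroup_imp_group[OF H])
      show ?thesis
        using gx powers by (intro H.unique_prime_subgroupI[OF q, of x]) auto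
    qed
  qed
  ultimately show ?thesis by simp
qed

end

theorem theorem4:
  fixes G (structure) and g :: 'a and gp :: "nat \<Rightarrow> 'a" and P :: "nat \<Rightarrow> 'a set"
    and \<pi> :: "nat set"
  assumes "group G" and "finite (carrier G)"
    and "g \<in> carrier G" and "g \<noteq> \<one>"
    and "\<pi> = prime_factors (group.ord G g)"
    and "\<And>p. p \<in> \<pi> \<Longrightarrow> p_element G p (gp p)"
    and "\<And>p q. p \<in> \<pi> \<Longrightarrow> q \<in> \<pi> \<Longrightarrow> gp p \<otimes> gp q = gp q \<otimes> gp p"
    and "g = (\<Otimes>p\<in>\<pi>. gp p)"
    and "\<And>p. p \<in> \<pi> \<Longrightarrow> sylow_subgroup G p (P p)"
  shows "dominating_vertex (cyclic_graph G) g \<longleftrightarrow>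
    (\<forall>p\<in>\<pi>. (cyclic_group (G\<lparr>carrier := P p\<rparr>) \<or> generalized_quaternion (G\<lparr>carrier := P p\<rparr>)) \<and>
            generate G {gp p} \<subseteq> P p \<inter> group_center G)"
proof -
  interpret group G by fact
  note fin = assms(2) and gG = assms(3) and gp = assms(6) and gcomm = assms(7) and syl = assms(9)
  have og: "ord g \<noteq> 0" using ord_ge_1[OF fin gG] by simp
  have finpi: "finite \<pi>" using assms(5) by simp
  have prime_pi: "\<And>p. p \<in> \<pi> \<Longrightarrow> prime p" and dvd_pi: "\<And>p. p \<in> \<pi> \<Longrightarrow> p dvd ord g"
    using assms(5) by auto
  have pi: "p \<in> \<pi>" if "prime p" "p dvd ord g" for p
    using that og assms(5) by (simp add: prime_factors_dvd)
  have gpG: "gp p \<in> carrier G" if "p \<in> \<pi>" for p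
    using gp[OF that] by (simp add: p_element_def)
  have part: "\<exists>k::nat. gp p = g [^] k" "gp p \<noteq> \<one>" if "p \<in> \<pi>" for p
    using primary_part_is_power[OF finpi prime_pi gp gcomm assms(8) that dvd_pi[OF that]] by auto
  have zed: "\<exists>k::nat. gp p [^] k \<noteq> \<one> \<and> (gp p [^] k) [^] p = \<one>" if p: "p \<in> \<pi>" for p
    using prime_order_power[OF gpG[OF p] prime_pi[OF p] _ part(2)[OF p]] gp[OF p]
    by (metis p_element_def)
  show ?thesis
  proof
    assume dom: "dominating_vertex (cyclic_graph G) g"
    have central: "g \<in> group_center G"
    proof -
      have "g \<otimes> x = x \<otimes> g" if x: "x \<in> carrier G" for x
      proof -
        obtain c and i j :: nat where "c \<in> carrier G" "g = c [^] i" "x = c [^] j"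
          using dominating_vertexD[OF fin dom x] .
        then show ?thesis by (simp add: nat_pow_comm)
      qed
      then show ?thesis using gG by (simp add: group_center_def)
    qed
    show "\<forall>p\<in>\<pi>. (cyclic_group (G\<lparr>carrier := P p\<rparr>) \<or> generalized_quaternion (G\<lparr>carrier := P p\<rparr>)) \<and>
            generate G {gp p} \<subseteq> P p \<inter> group_center G"
    proof
      fix p assume p: "p \<in> \<pi>"
      have P: "subgroup (P p) G" and cardP: "card (P p) = p ^ multiplicity p (order G)"
        using syl[OF p] by (auto simp: sylow_subgroup_def)
      obtain k :: nat where k: "gp p = g [^] k" using part(1)[OF p] by blast
      have gpZ: "gp p \<in> group_center G" using central_pow[OF central] k by simp
      obtain e where e: "ord (gp p) = p ^ e" using gp[OF p] by (auto simp: p_element_def)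
      obtain l :: nat where l: "gp p [^] l \<noteq> \<one>" "(gp p [^] l) [^] p = \<one>" using zed[OF p] by blast
      define z where "z = gp p [^] l"
      have z: "z \<in> carrier G" "z \<noteq> \<one>" "z [^] p = \<one>" "z = g [^] (k * l)"
        using l gpG[OF p] k gG by (auto simp: z_def nat_pow_pow)
      have uniq: "unique_prime_subgroup G p"
      proof (rule unique_prime_subgroupI[OF prime_pi[OF p] z(1)])
        fix x assume x: "x \<in> carrier G" "x [^] p = \<one>"
        obtain c and i j :: nat where c: "c \<in> carrier G" "g = c [^] i" "x = c [^] j"
          using dominating_vertexD[OF fin dom x(1)] .
        have "z = c [^] (i * (k * l))" using z c by (simp add: nat_pow_pow)
        then show "\<exists>i::nat. x = z [^] i"
          using power_of_prime_order_element[OF prime_pi[OF p] c(1) c(3) x(2) _ z(3,2)] by blast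
      qed
      interpret P: group "G\<lparr>carrier := P p\<rparr>" by (rule subgroup_imp_group[OF P])
      have "unique_prime_subgroup (G\<lparr>carrier := P p\<rparr>) p"
        using uniq subgroup.subset[OF P] by (auto simp: unique_prime_subgroup_def subset_iff)
      then have "cyclic_group (G\<lparr>carrier := P p\<rparr>) \<or> generalized_quaternion (G\<lparr>carrier := P p\<rparr>)"
        using P.p_group_unique_prime_subgroup[OF prime_pi[OF p]] cardP by (simp add: order_def)
      moreover have "gp p \<in> P p"
      proof -
        have "gp p [^] (p ^ e) = \<one>" using pow_eq_id[OF gpG[OF p]] e by simp
        then obtain h where h: "h \<in> carrier G" "h \<otimes> gp p \<otimes> inv h \<in> P p"
          using conjugate_into_sylow_subgroup[OF fin syl[OF p] gpG[OF p]] by blast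
        have "h \<otimes> gp p = gp p \<otimes> h" using gpZ h by (simp add: group_center_def)
        then have "h \<otimes> gp p \<otimes> inv h = gp p" using h gpG[OF p] by (simp add: m_assoc)
        then show ?thesis using h by simp
      qed
      then have "generate G {gp p} \<subseteq> P p \<inter> group_center G"
        unfolding generate_pow_on_finite_carrier[OF fin gpG[OF p]]
        using pow_subgroup_closed[OF P] central_pow[OF gpZ] by auto
      ultimately show "(cyclic_group (G\<lparr>carrier := P p\<rparr>) \<or> generalized_quaternion (G\<lparr>carrier := P p\<rparr>)) \<and>
            generate G {gp p} \<subseteq> P p \<inter> group_center G" by blast
    qed
  next
    assume R: "\<forall>p\<in>\<pi>. (cyclic_group (G\<lparr>carrier := P p\<rparr>) \<or> generalized_quaternion (G\<lparr>carrier := P p\<rparr>)) \<and>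
            generate G {gp p} \<subseteq> P p \<inter> group_center G"
    have gpPZ: "gp p [^] (k::nat) \<in> P p" "gp p [^] k \<in> group_center G" if "p \<in> \<pi>" for p k
      using R that generate_pow_on_finite_carrier[OF fin gpG[OF that]] by blast+
    have gpZ: "x \<otimes> gp p = gp p \<otimes> x" if "p \<in> \<pi>" "x \<in> carrier G" for p x
      using gpPZ(2)[OF that(1), of 1] that gpG by (simp add: group_center_def)
    have "x \<otimes> finprod G gp \<pi> = finprod G gp \<pi> \<otimes> x" if "x \<in> carrier G" for x
      by (rule finprod_commutes[OF finpi gpG gcomm that gpZ[OF _ that]])
    then have "x \<otimes> g = g \<otimes> x" if "x \<in> carrier G" for x
      using that assms(8) by metis
    then have central: "g \<in> group_center G" using gG by (simp add: group_center_def)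
    have uniq: "unique_prime_subgroup G p" if p: "prime p" "p dvd ord g" for p
    proof -
      have pp: "p \<in> \<pi>" using pi p by blast
      have P: "subgroup (P p) G" and cardP: "card (P p) = p ^ multiplicity p (order G)"
        using syl[OF pp] by (auto simp: sylow_subgroup_def)
      interpret P: group "G\<lparr>carrier := P p\<rparr>" by (rule subgroup_imp_group[OF P])
      have finP: "finite (P p)" using subgroup.subset[OF P] fin finite_subset by blast
      have uP: "unique_prime_subgroup (G\<lparr>carrier := P p\<rparr>) p"
      proof (cases "cyclic_group (G\<lparr>carrier := P p\<rparr>)")
        case True
        then show ?thesis using P.cyclic_unique_prime_subgroup[OF _ _ p(1)] finP by simp
      next
        case False
        then have gq: "generalized_quaternion (G\<lparr>carrier := P p\<rparr>)" using R pp by blast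
        then obtain n where "n \<ge> 3" "card (P p) = 2 ^ n"
          unfolding generalized_quaternion_def order_def by auto
        then have "2 dvd p ^ multiplicity p (order G)" using cardP by simp
        then have "2 dvd p" using prime_dvd_power two_is_prime_nat by blast
        then have "p = 2" using primes_dvd_imp_eq[OF two_is_prime_nat p(1)] by simp
        then show ?thesis using P.generalized_quaternion_unique_prime_subgroup[OF gq] by simp
      qed
      obtain k :: nat where k: "gp p [^] k \<noteq> \<one>" "(gp p [^] k) [^] p = \<one>" using zed[OF pp] by blast
      show ?thesis
        by (rule unique_prime_subgroup_of_sylow[OF fin syl[OF pp] uP gpPZ[OF pp] k(2,1)])
    qed
    have "(g, x) \<in> parcs (cyclic_graph G)" if "x \<in> pverts (cyclic_graph G)" "x \<noteq> g" for x
      using that gG assms(4) cyclic_generated_with_central[OF fin central _ uniq]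
      by (simp add: cyclic_graph_def)
    then show "dominating_vertex (cyclic_graph G) g"
      using gG assms(4) by (simp add: dominating_vertex_def cyclic_graph_def)
  qed
qed

end
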